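(* Let $Q:\mathbb{R}^d\to\mathbb{R}$ be continuous such that $|Q|$ is positive homogeneous with homogeneous order $\mu=\mu_{|Q|}$, and for $\tau>0$ let $\mathcal O_\tau=\{\xi\in\mathbb{R}^d:|Q(\xi)|<\tau\}$. Suppose $\mu<1$. Then: (1) For every $t>0$ and $x\in\mathbb{R}^d$ the limit $H_{iQ}^t(x):=\frac{1}{(2\pi)^d}\lim_{\tau\to\infty}\int_{\mathcal O_\tau}e^{-itQ(\xi)-ix\cdot\xi}\,d\xi$ exists, and $(t,x)\mapsto H^t_{iQ}(x)$ is continuous on $(0,\infty)\times\mathbb{R}^d$. (2) For each $t_0>0$ and compact $K\subseteq\mathbb{R}^d$, this limit is uniform for $t\ge t_0$, $x\in K$: for every $\epsilon>0$ there is $\tau_0$ with $\left|(2\pi)^dH^t_{iQ}(x)-\int_{\mathcal O_\tau}e^{-itQ(\xi)-ix\cdot\xi}d\xi\right|<\epsilon$ for all $\tau\ge\tau_0$, $t\ge t_0$, $x\in K$. (3) For every $E\in\mathrm{Exp}(Q)$, $H^t_{iQ}(x)=t^{-\mu}H^1_{iQ}(t^{-E^*}x)$ for all $t>0$, $x\in\mathbb{R}^d$. (4) For all $t>0$, $\mathrm{Re}\,H^t_{iQ}(0)=\frac{t^{-\mu}}{(2\pi)^d}m(B_{|Q|})\Gamma(1+\mu)\cos(\mu\pi/2)>0$, where $B_{|Q|}=\{\xi:|Q(\xi)|<1\}$, $m$ is Lebesgue measure and $\Gamma$ is Euler's Gamma function.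
   Context: For $E\in\mathrm{End}(\mathbb{R}^d)$, $t>0$, $t^E:=\exp(\log(t)E)$, and $E^*$ is the adjoint. $P:\mathbb{R}^d\to\mathbb{C}$ is homogeneous w.r.t. $E$ if $P(t^E\xi)=tP(\xi)$ for all $t>0,\xi$; $\mathrm{Exp}(P)$ is the set of such $E$. A real $P$ is positive definite if $P\ge0$ and vanishes only at $0$. $P:\mathbb{R}^d\to\mathbb{R}$ is positive homogeneous if continuous, positive definite, $\mathrm{Exp}(P)\ne\emptyset$, and $S_P=\{P=1\}$ compact; its homogeneous order $\mu_P$ is the common value $\mathrm{tr}E$, $E\in\mathrm{Exp}(P)$. (For continuous real $Q$ with $|Q|$ positive homogeneous, $\mathrm{Exp}(Q)=\mathrm{Exp}(|Q|)$.) *)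

theory Defs
  imports "HOL-Analysis.Analysis"
begin

primrec mpow :: "real^'n^'n \<Rightarrow> nat \<Rightarrow> real^'n^'n" where
  "mpow A 0 = mat 1"
| "mpow A (Suc k) = A ** mpow A k"

definition mexp :: "real^'n^'n \<Rightarrow> real^'n^'n" where
  "mexp A = (\<Sum>k. (1 / fact k) *\<^sub>R mpow A k)"

definition tpow :: "real \<Rightarrow> real^'n^'n \<Rightarrow> real^'n^'n" where
  "tpow t E = mexp (ln t *\<^sub>R E)"

definition ExpSet :: "(real^'n \<Rightarrow> real) \<Rightarrow> (real^'n^'n) set" where
  "ExpSet P = {E. \<forall>t>0. \<forall>\<xi>. P (tpow t E *v \<xi>) = t * P \<xi>}"

definition pos_definite :: "(real^'n \<Rightarrow> real) \<Rightarrow> bool" where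
  "pos_definite P \<longleftrightarrow> (\<forall>\<xi>. P \<xi> \<ge> 0) \<and> (\<forall>\<xi>. P \<xi> = 0 \<longrightarrow> \<xi> = 0)"

definition pos_homogeneous :: "(real^'n \<Rightarrow> real) \<Rightarrow> bool" where
  "pos_homogeneous P \<longleftrightarrow> continuous_on UNIV P \<and> pos_definite P \<and> ExpSet P \<noteq> {}
     \<and> compact {\<xi>. P \<xi> = 1}"

text \<open>Homogeneous order mu_P = tr E for (any) E in Exp(P).\<close>
definition hom_order :: "(real^'n \<Rightarrow> real) \<Rightarrow> real" where
  "hom_order P = trace (SOME E. E \<in> ExpSet P)"

definition osc_int :: "(real^'n \<Rightarrow> real) \<Rightarrow> real \<Rightarrow> real \<Rightarrow> real^'n \<Rightarrow> complex" where
  "osc_int Q \<tau> t x = (LINT \<xi>:{\<xi>. \<bar>Q \<xi>\<bar> < \<tau>}|lborel.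
       exp (- \<i> * complex_of_real (t * Q \<xi>) - \<i> * complex_of_real (x \<bullet> \<xi>)))"

definition H_iQ :: "(real^'n \<Rightarrow> real) \<Rightarrow> real \<Rightarrow> real^'n \<Rightarrow> complex" where
  "H_iQ Q t x = complex_of_real (1 / (2 * pi) ^ CARD('n)) * Lim at_top (\<lambda>\<tau>. osc_int Q \<tau> t x)"

end

theory Submission
  imports Defs
begin

text \<open>
  Write \<open>T s = mexp (s *\<^sub>R E)\<close> for \<open>E\<close> in \<open>ExpSet Q\<close>, so that \<open>Q (T s *v \<xi>) = exp s * Q \<xi>\<close> and
  \<open>det (T s) = exp (s * \<mu>)\<close> with \<open>\<mu> = trace E\<close>. Compactness of \<open>\<bar>Q\<bar> = 1\<close> makes the sublevel sets bounded, hence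
  \<open>T (- s)\<close> is bounded for \<open>s \<ge> 0\<close> and, by Cramer's rule, \<open>T s\<close> grows at most like \<open>exp (\<mu> * s)\<close>.
  In polar coordinates \<open>\<xi> = T s *v \<eta>\<close> the phase is \<open>t * exp s * Q \<eta> + x \<bullet> (T s *v \<eta>)\<close>; as \<open>\<mu> < 1\<close>, the
  first summand and its derivatives dominate, locally uniformly in \<open>x\<close>, and one integration by parts bounds the tail
  of the integral beyond \<open>\<bar>Q\<bar> = \<tau>\<close> by a multiple of \<open>\<tau> powr (\<mu> - 1)\<close>.
  The function \<open>Q\<close> is never differentiated, being exactly exponential along the flow. The scaling law is the
  substitution by \<open>T (- ln t)\<close>, and at \<open>x = 0\<close> the integral reduces to the Mellin transform of the cosine.
\<close>

section \<open>The matrix exponential\<close>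

text \<open>The integrand has modulus 1, so along an orbit the amplitude is
  \<open>exp (s * \<mu>)\<close>, which is not integrable at infinity: convergence is only
  conditional and must come from dividing once by the derivative of the phase, of size
  \<open>t * exp s\<close>. Since \<open>Q\<close> is merely continuous, its level sets need not be
  smooth; the logarithmic variable \<open>s\<close> avoids them, because the phase is smooth along
  each orbit however \<open>Q\<close> behaves across orbits. Differentiating
  \<open>x \<bullet> (T s *v \<eta>)\<close> in \<open>s\<close> only replaces \<open>x\<close> by
  \<open>transpose E *v x\<close>, so every derivative inherits the growth of \<open>T s\<close>.
  That growth needs no normal form of \<open>E\<close>: the singular values of \<open>T s\<close>
  have product \<open>exp (s * \<mu>)\<close> and a common positive lower bound for
  \<open>s \<ge> 0\<close>, so none exceeds a multiple of \<open>exp (\<mu> * s)\<close>; Cramer's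
  rule is the entrywise form of this. Thus \<open>\<mu> < 1\<close> acts twice, against the
  perturbation of the phase and against the amplitude. As the constants depend only on a lower bound
  for \<open>t\<close> and an upper bound for \<open>norm x\<close>, existence, uniformity and
  continuity all follow from one tail estimate.\<close>

lemma bounded_linear_matrix_mult_left: "bounded_linear (\<lambda>X::real^'n^'n. A ** X)"
  by (auto simp: linear_conv_bounded_linear[symmetric] linear_iff matrix_add_ldistrib matrix_scalar_ac
      scalar_matrix_assoc simp flip: scalar_matrix_assoc)

lemma bounded_linear_matrix_mult_right: "bounded_linear (\<lambda>X::real^'n^'n. X ** A)"
  by (auto simp: linear_conv_bounded_linear[symmetric] linear_iff matrix_matrix_mult_def vec_eq_iff
      algebra_simps sum.distrib sum_distrib_left)

lemma bounded_linear_transpose: "bounded_linear (transpose :: real^'n^'n \<Rightarrow> real^'n^'n)"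
  by (auto simp: linear_conv_bounded_linear[symmetric] linear_iff transpose_def vec_eq_iff)

lemma bounded_linear_matrix_entry: "bounded_linear (\<lambda>X::real^'n^'m. X $ i $ j)"
  by (intro bounded_linear_compose[OF bounded_linear_vec_nth] bounded_linear_vec_nth)

lemma mpow_scaleR: "mpow (c *\<^sub>R A) k = c ^ k *\<^sub>R mpow A k"
  by (induction k) (simp_all add: matrix_scalar_ac flip: scalar_matrix_assoc)

lemma mpow_commute: "mpow A k ** A = A ** mpow A k"
  by (induction k) (simp_all add: matrix_mul_assoc[symmetric])

lemma mpow_transpose: "mpow (transpose A) k = transpose (mpow A k)"
  by (induction k) (simp_all add: matrix_transpose_mul transpose_mat mpow_commute[symmetric])

lemma abs_mpow_entry_le:
  fixes A :: "real^'n^'n"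
  shows "\<bar>mpow A k $ i $ j\<bar> \<le> (real CARD('n) * norm A) ^ k"
proof (induction k arbitrary: i j)
  case (Suc k)
  have A: "\<bar>A $ i $ l\<bar> \<le> norm A" for l
    using component_le_norm_cart[of "A $ i" l] Finite_Cartesian_Product.norm_nth_le[of A i] by linarith
  have "\<bar>mpow A (Suc k) $ i $ j\<bar> \<le> (\<Sum>l\<in>UNIV. \<bar>A $ i $ l * mpow A k $ l $ j\<bar>)"
    by (simp add: matrix_matrix_mult_def sum_abs)
  also have "\<dots> \<le> (\<Sum>l\<in>(UNIV::'n set). norm A * (real CARD('n) * norm A) ^ k)"
    unfolding abs_mult by (intro sum_mono mult_mono A Suc.IH) auto
  finally show ?case by simp
qed (simp add: mat_def)

text \<open>The factor \<open>s ^ k\<close> presents each entry of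
  \<open>mexp (s *\<^sub>R A)\<close> as a real power series convergent everywhere, so that
  differentiation in \<open>s\<close> can be done termwise.\<close>

lemma summable_mexp_entry:
  fixes A :: "real^'n^'n"
  shows "summable (\<lambda>k. mpow A k $ i $ j / fact k * s ^ k)"
proof (rule summable_comparison_test')
  show "summable (\<lambda>k. inverse (fact k) * (real CARD('n) * norm A * \<bar>s\<bar>) ^ k)"
    by (rule summable_exp)
  show "norm (mpow A k $ i $ j / fact k * s ^ k) \<le> inverse (fact k) * (real CARD('n) * norm A * \<bar>s\<bar>) ^ k" for k
    using mult_right_mono[OF abs_mpow_entry_le[of A k i j], of "\<bar>s\<bar> ^ k / fact k"]
    by (simp add: abs_mult power_abs power_mult_distrib field_simps)
qed

lemma sums_mexp:
  fixes A :: "real^'n^'n"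
  shows "(\<lambda>k. (1 / fact k) *\<^sub>R mpow A k) sums mexp A"
proof -
  have "(\<lambda>n. \<Sum>k<n. (1 / fact k) *\<^sub>R mpow A k)
          \<longlonglongrightarrow> (\<chi> i j. \<Sum>k. mpow A k $ i $ j / fact k)"
  proof (intro vec_tendstoI)
    fix i j
    show "(\<lambda>n. (\<Sum>k<n. (1 / fact k) *\<^sub>R mpow A k) $ i $ j)
            \<longlonglongrightarrow> (\<chi> i j. \<Sum>k. mpow A k $ i $ j / fact k) $ i $ j"
      using summable_LIMSEQ[OF summable_mexp_entry[of A i j 1]] by simp
  qed
  then have "summable (\<lambda>k. (1 / fact k) *\<^sub>R mpow A k)"
    unfolding summable_def sums_def by blast
  then show ?thesis unfolding mexp_def by (rule summable_sums)
qed

lemma mexp_scaleR_entry: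
  "mexp (s *\<^sub>R A) $ i $ j = (\<Sum>k. mpow A k $ i $ j / fact k * s ^ k)"
  using bounded_linear.sums[OF bounded_linear_matrix_entry[of i j] sums_mexp[of "s *\<^sub>R A"]]
  by (auto simp: mpow_scaleR sums_iff mult.commute)

lemma mexp_transpose: "mexp (transpose A) = transpose (mexp A)"
  using bounded_linear.sums[OF bounded_linear_transpose sums_mexp[of A]] sums_mexp[of "transpose A"]
  by (simp add: mpow_transpose linear_simps[OF bounded_linear_transpose] sums_iff)

lemma mexp_commute: "mexp A ** A = A ** mexp A"
  using bounded_linear.sums[OF bounded_linear_matrix_mult_left[of A] sums_mexp[of A]]
    bounded_linear.sums[OF bounded_linear_matrix_mult_right[of A] sums_mexp[of A]]
  by (simp add: mpow_commute linear_simps[OF bounded_linear_matrix_mult_left]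
      linear_simps[OF bounded_linear_matrix_mult_right] sums_iff)

lemma mexp_0 [simp]: "mexp (0 :: real^'n^'n) = mat 1"
proof -
  have "(\<lambda>k. (1 / fact k) *\<^sub>R mpow (0::real^'n^'n) k) = (\<lambda>k. if k = 0 then mat 1 else 0)"
    by (rule ext, case_tac k) simp_all
  then have "(\<lambda>k. if k = 0 then mat 1 else 0) sums mexp (0 :: real^'n^'n)"
    using sums_mexp[of "0 :: real^'n^'n"] by (simp only:)
  then show ?thesis
    by (rule sums_unique2) (rule sums_single)
qed

text \<open>Termwise differentiation shifts the coefficients by one, and the recursion of
  \<open>mpow\<close> turns this shift into left multiplication by \<open>A\<close>.\<close>

lemma mexp_entry_has_derivative:
  "((\<lambda>s. mexp (s *\<^sub>R A) $ i $ j) has_real_derivative (A ** mexp (s *\<^sub>R A)) $ i $ j) (at s)"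
proof -
  let ?c = "\<lambda>i k. mpow A k $ i $ j / fact k"
  have "((\<lambda>s. \<Sum>k. ?c i k * s ^ k) has_real_derivative (\<Sum>k. diffs (?c i) k * s ^ k)) (at s)"
    by (intro termdiffs_strong_converges_everywhere summable_mexp_entry)
  moreover have "diffs (?c i) k * s ^ k = (\<Sum>l\<in>UNIV. A $ i $ l * (?c l k * s ^ k))" for k
    by (simp add: diffs_def matrix_matrix_mult_def sum_divide_distrib sum_distrib_left sum_distrib_right mult.assoc)
  moreover have "(\<Sum>k. \<Sum>l\<in>UNIV. A $ i $ l * (?c l k * s ^ k)) = (A ** mexp (s *\<^sub>R A)) $ i $ j"
    by (simp only: suminf_sum[OF summable_mult[OF summable_mexp_entry]]
        suminf_mult[OF summable_mexp_entry] matrix_matrix_mult_def mexp_scaleR_entry vec_lambda_beta)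
  ultimately show ?thesis
    by (simp add: mexp_scaleR_entry)
qed

text \<open>The product \<open>?T (- u) ** ?T (u + a)\<close> has zero derivative in
  \<open>u\<close>, because \<open>A\<close> commutes with \<open>?T (- u)\<close> and the two terms
  of the product rule cancel. Its value at 0 then gives the group law.\<close>

lemma mexp_add:
  fixes A :: "real^'n^'n"
  shows "mexp ((s + t) *\<^sub>R A) = mexp (s *\<^sub>R A) ** mexp (t *\<^sub>R A)"
proof -
  let ?T = "\<lambda>s. mexp (s *\<^sub>R A)"
  have comm: "A ** ?T s = ?T s ** A" for s
  proof (cases "s = 0")
    case False
    have "s *\<^sub>R (?T s ** A) = s *\<^sub>R (A ** ?T s)"
      using mexp_commute[of "s *\<^sub>R A"] by (simp add: matrix_scalar_ac flip: scalar_matrix_assoc)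
    with False show ?thesis by simp
  qed simp
  have const: "?T (- s) ** ?T (s + a) = ?T a" for s a
  proof -
    have "(?T (- s) ** ?T (s + a)) $ i $ j = (?T (- 0) ** ?T (0 + a)) $ i $ j" for i j
    proof (rule DERIV_isconst_all[where f = "\<lambda>u. (?T (- u) ** ?T (u + a)) $ i $ j"], rule allI)
      fix u
      have d1: "((\<lambda>u. ?T (- u) $ i $ l) has_real_derivative - (A ** ?T (- u)) $ i $ l) (at u)" for l
        using DERIV_chain2[OF mexp_entry_has_derivative[of A i l] DERIV_minus[OF DERIV_ident], of u] by simp
      have d2: "((\<lambda>u. ?T (u + a) $ l $ j) has_real_derivative (A ** ?T (u + a)) $ l $ j) (at u)" for l
        using DERIV_chain2[OF mexp_entry_has_derivative[of A l j] DERIV_add[OF DERIV_ident DERIV_const], of a u] by simp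
      have "((\<lambda>u. (?T (- u) ** ?T (u + a)) $ i $ j) has_real_derivative
          (\<Sum>l\<in>UNIV. - (A ** ?T (- u)) $ i $ l * ?T (u + a) $ l $ j
             + ?T (- u) $ i $ l * (A ** ?T (u + a)) $ l $ j)) (at u)"
        unfolding matrix_matrix_mult_def[of "?T _" "?T _"]
        unfolding vec_lambda_beta by (rule DERIV_sum, rule DERIV_cong[OF DERIV_mult'[OF d1 d2]]) simp
      moreover have "(\<Sum>l\<in>UNIV. - (A ** ?T (- u)) $ i $ l * ?T (u + a) $ l $ j
             + ?T (- u) $ i $ l * (A ** ?T (u + a)) $ l $ j) =
           - ((A ** ?T (- u)) ** ?T (u + a)) $ i $ j + (?T (- u) ** (A ** ?T (u + a))) $ i $ j"
        unfolding matrix_matrix_mult_def[of "A ** ?T (- u)"] matrix_matrix_mult_def[of "?T (- u)"]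
        by (simp add: sum_subtractf)
      moreover have "\<dots> = 0"
        using comm[of "- u"] by (simp add: matrix_mul_assoc)
      ultimately show "((\<lambda>u. (?T (- u) ** ?T (u + a)) $ i $ j) has_real_derivative 0) (at u)"
        by simp
    qed
    then show ?thesis by (simp add: vec_eq_iff)
  qed
  have "?T (- (- s)) ** ?T (- s + (s + t)) = ?T (s + t)"
    by (rule const)
  then show ?thesis by simp
qed

lemma mexp_minus_mult [simp]: "mexp (- (s *\<^sub>R A)) ** mexp (s *\<^sub>R A) = mat 1"
  using mexp_add[of "- s" s A] by simp

lemma mexp_mult_minus [simp]: "mexp (s *\<^sub>R A) ** mexp (- (s *\<^sub>R A)) = mat 1"
  using mexp_add[of s "- s" A] by simp

text \<open>Injectivity leaves no value for \<open>p i\<close> other than \<open>i\<close>. This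
  eliminates the terms of the differentiated Leibniz formula in which all rows but one must agree
  with the identity matrix.\<close>

lemma permutes_eq_id_if_fixes_others:
  assumes "p permutes S" and "\<And>j. j \<in> S \<Longrightarrow> j \<noteq> i \<Longrightarrow> p j = j"
  shows "p = id"
proof -
  have "p i = i"
  proof (rule ccontr)
    assume "p i \<noteq> i"
    then have "i \<in> S" "p i \<in> S"
      using assms(1) by (auto simp: permutes_in_image permutes_def)
    with assms \<open>p i \<noteq> i\<close> have "p (p i) = p i" by blast
    with assms(1) \<open>p i \<noteq> i\<close> show False
      by (metis permutes_inj injD)
  qed
  with assms show ?thesis
    by (metis eq_id_iff permutes_not_in)
qed

text \<open>Only the identity permutation survives when the determinant of
  \<open>mexp (s *\<^sub>R A)\<close> is differentiated at 0.\<close>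

lemma det_mexp:
  fixes A :: "real^'n^'n"
  shows "det (mexp (s *\<^sub>R A)) = exp (s * trace A)"
proof -
  let ?D = "\<lambda>s. det (mexp (s *\<^sub>R A))"
  \<comment> \<open>A permutation other than the identity moves at least two points, so whichever
    row \<open>i\<close> is differentiated, another row still contributes an off-diagonal
    zero.\<close>
  have e0: "(\<Sum>i\<in>UNIV. A $ i $ p i * (\<Prod>j\<in>UNIV - {i}. (mat 1 :: real^'n^'n) $ j $ p j)) =
        (if p = id then trace A else 0)" if "p permutes UNIV" for p :: "'n \<Rightarrow> 'n"
  proof (cases "p = id")
    case False
    have "(\<Prod>j\<in>UNIV - {i}. (mat 1 :: real^'n^'n) $ j $ p j) = 0" for i
    proof -
      obtain j where "j \<noteq> i" "p j \<noteq> j"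
        using permutes_eq_id_if_fixes_others[OF \<open>p permutes UNIV\<close>, of i] False by auto
      then show ?thesis by (intro prod_zero) (auto simp: mat_def intro!: bexI[of _ j])
    qed
    then show ?thesis unfolding if_not_P[OF False] by (intro sum.neutral) (simp only: mult_zero_right simp_thms ball_UNIV)
  qed (auto simp: trace_def mat_def)
  have "(?D has_real_derivative (\<Sum>p | p permutes (UNIV :: 'n set). of_int (sign p) *
        (\<Sum>i\<in>UNIV. A $ i $ p i * (\<Prod>j\<in>UNIV - {i}. (mat 1 :: real^'n^'n) $ j $ p j)))) (at 0)"
  proof -
    have "((\<lambda>s. mexp (s *\<^sub>R A) $ i $ j) has_real_derivative A $ i $ j) (at 0)" for i j
      using mexp_entry_has_derivative[of A i j 0] by simp
    from has_field_derivative_prod[OF this]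
    have "((\<lambda>s. \<Prod>i\<in>UNIV. mexp (s *\<^sub>R A) $ i $ p i) has_real_derivative
        (\<Sum>i\<in>UNIV. A $ i $ p i * (\<Prod>j\<in>UNIV - {i}. (mat 1 :: real^'n^'n) $ j $ p j))) (at 0)" for p :: "'n \<Rightarrow> 'n"
      by simp
    then show ?thesis
      unfolding det_def by (intro DERIV_sum DERIV_cmult)
  qed
  also have "(\<Sum>p | p permutes (UNIV :: 'n set). of_int (sign p) *
        (\<Sum>i\<in>UNIV. A $ i $ p i * (\<Prod>j\<in>UNIV - {i}. (mat 1 :: real^'n^'n) $ j $ p j))) =
      (\<Sum>p | p permutes (UNIV :: 'n set). if p = id then trace A else 0)"
    using e0 by (intro sum.cong) (auto simp: sign_id)
  also have "\<dots> = trace A"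
    by (simp add: permutes_id finite_permutations)
  finally have d0: "(?D has_real_derivative trace A) (at 0)" .
  \<comment> \<open>The group law and multiplicativity of \<open>det\<close> carry the derivative
    from 0 to \<open>u\<close>; the resulting linear equation is then solved by an integrating
    factor.\<close>
  have d: "(?D has_real_derivative trace A * ?D u) (at u)" for u
  proof -
    have "((\<lambda>s. ?D (s + - u) * ?D u) has_real_derivative trace A * ?D u) (at u)"
      by (rule DERIV_cmult_right, subst DERIV_shift[symmetric]) (use d0 in simp)
    moreover have "?D (s + - u) * ?D u = ?D s" for s
      using mexp_add[of "s - u" u A] by (simp add: det_mul)
    ultimately show ?thesis by simp
  qed
  have "?D s * exp (- s * trace A) = ?D 0 * exp (- 0 * trace A)"
    by (rule DERIV_isconst_all[where f = "\<lambda>s. ?D s * exp (- s * trace A)"]) (auto intro!: derivative_eq_intros d)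
  then show ?thesis by (simp add: exp_minus field_simps)
qed

section \<open>Linear change of variables\<close>

text \<open>The fact \<open>measure_linear_image\<close> without its well-order on the index type.\<close>

lemma measure_linear_image_finite:
  fixes f :: "real^'n \<Rightarrow> real^'n"
  assumes "linear f"
  shows "\<forall>S\<in>lmeasurable. f ` S \<in> lmeasurable \<and>
           measure lebesgue (f ` S) = \<bar>det (matrix f)\<bar> * measure lebesgue S" (is "?P f")
proof (rule induct_linear_elementary[OF assms])
  fix f g :: "real^'n \<Rightarrow> real^'n"
  assume "linear f" "linear g" "?P f" "?P g"
  then show "?P (f \<circ> g)"
    unfolding image_comp[symmetric] matrix_compose[OF \<open>linear g\<close> \<open>linear f\<close>]
    by (simp add: det_mul abs_mult)
next
  fix f :: "real^'n \<Rightarrow> real^'n" and i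
  assume f: "linear f" "\<And>x. f x $ i = 0"
  then have "\<not> surj f"
    by (metis surjD vec_component zero_neq_one)
  then have "\<not> inj f"
    using f(1) linear_injective_imp_surjective by blast
  then have "negligible (f ` S)" "det (matrix f) = 0" for S
    using f(1) negligible_linear_singular_image det_nz_iff_inj by blast+
  then show "?P f"
    by (simp add: negligible_imp_measurable negligible_imp_measure0)
next
  fix c :: "'n \<Rightarrow> real"
  show "?P (\<lambda>x. \<chi> i. c i * x $ i)"
    by (auto simp: measurable_stretch measure_stretch det_diagonal matrix_def axis_def)
next
  fix m n :: 'n
  assume "m \<noteq> n"
  let ?\<sigma> = "Transposition.transpose m n"
  let ?h = "\<lambda>x::real^'n. \<chi> i. x $ ?\<sigma> i"
  have lin: "linear ?h"
    by (rule linearI) (simp_all add: vec_eq_iff)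
  have "matrix ?h = (\<chi> i. mat 1 $ ?\<sigma> i)"
    by (auto simp: matrix_def mat_def axis_def vec_eq_iff)
  then have det: "\<bar>det (matrix ?h)\<bar> = 1"
    by (simp add: det_permute_rows permutes_swap_id sign_swap_id abs_mult)
  have box: "measure lebesgue (?h ` cbox a b) = 1 * measure lebesgue (cbox a b)" for a b
  proof -
    have eq: "?h ` cbox a b = cbox (?h a) (?h b)"
    proof (intro equalityI subsetI)
      fix y assume "y \<in> cbox (?h a) (?h b)"
      then have "a $ ?\<sigma> (?\<sigma> i) \<le> y $ ?\<sigma> i \<and> y $ ?\<sigma> i \<le> b $ ?\<sigma> (?\<sigma> i)" for i
        unfolding mem_box_cart vec_lambda_beta by blast
      then have "?h y \<in> cbox a b" "y = ?h (?h y)"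
        by (simp_all add: mem_box_cart vec_eq_iff)
      then show "y \<in> ?h ` cbox a b" by blast
    qed (auto simp: mem_box_cart)
    have "cbox (?h a) (?h b) = {} \<longleftrightarrow> cbox a b = {}"
      unfolding eq[symmetric] by simp
    moreover have "(\<Prod>i\<in>UNIV. b $ ?\<sigma> i - a $ ?\<sigma> i) = (\<Prod>i\<in>UNIV. b $ i - a $ i)"
      using prod.permute[OF permutes_swap_id[of m UNIV n], of "\<lambda>i. b $ i - a $ i"] by (simp add: o_def)
    ultimately show ?thesis
      unfolding eq by (simp add: content_cbox_if_cart)
  qed
  show "?P ?h"
  proof
    fix S :: "(real^'n) set"
    assume "S \<in> lmeasurable"
    note * = measure_linear_sufficient[OF lin this box, unfolded mult_1]
    show "?h ` S \<in> lmeasurable \<and>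
        measure lebesgue (?h ` S) = \<bar>det (matrix ?h)\<bar> * measure lebesgue S"
      unfolding det abs_one mult_1 by (rule conjI[OF conjunct1[OF *] conjunct2[OF *, symmetric]])
  qed
next
  fix m n :: 'n
  assume "m \<noteq> n"
  let ?h = "\<lambda>x::real^'n. \<chi> i. if i = m then x $ m + x $ n else x $ i"
  have lin: "linear ?h"
    by (rule linearI) (auto simp: vec_eq_iff algebra_simps)
  have "matrix ?h = (\<chi> k. if k = m then row m (mat 1) + 1 *s row n (mat 1) else row k (mat 1))"
    by (auto simp: matrix_def mat_def axis_def vec_eq_iff row_def)
  then have det: "det (matrix ?h) = 1"
    using det_row_operation[OF \<open>m \<noteq> n\<close>, of "mat 1" 1] by simp
  have box: "measure lebesgue (?h ` cbox a b) = 1 * measure lebesgue (cbox a b)" for a b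
  proof (cases "cbox a b = {}")
    case False
    \<comment> \<open>The shear formula for boxes is applied to a box whose lower
      \<open>n\<close>-th coordinate is nonnegative; translation by \<open>v\<close> moves that
      coordinate to 0, and the shear maps the translate back up to a translation.\<close>
    define v :: "real^'n" where "v = (\<chi> i. if i = n then - a $ n else 0)"
    have nn: "(v + a) $ n = 0" 
      by (simp add: v_def)
    have ne: "cbox (v + a) (v + b) \<noteq> {}"
      using False by (simp add: cbox_translation)
    have shift: "?h x = - ?h v + ?h (v + x)" for x
      using linear_add[OF lin, of v x] by simp
    have "?h ` cbox a b = (+) (- ?h v) ` ?h ` cbox (v + a) (v + b)"
      unfolding cbox_translation image_comp o_def by (intro image_cong refl shift)
    then have "measure lebesgue (?h ` cbox a b) = measure lebesgue (?h ` cbox (v + a) (v + b))"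
      by (simp only: measure_translation)
    also have "\<dots> = measure lebesgue (cbox (v + a) (v + b))"
      by (rule measure_shear_interval[OF \<open>m \<noteq> n\<close> ne]) (simp only: nn order_refl)
    finally show ?thesis
      by (simp only: cbox_translation measure_translation mult_1)
  qed simp
  show "?P ?h"
  proof
    fix S :: "(real^'n) set"
    assume "S \<in> lmeasurable"
    note * = measure_linear_sufficient[OF lin this box, unfolded mult_1]
    show "?h ` S \<in> lmeasurable \<and>
        measure lebesgue (?h ` S) = \<bar>det (matrix ?h)\<bar> * measure lebesgue S"
      unfolding det abs_one mult_1 by (rule conjI[OF conjunct1[OF *] conjunct2[OF *, symmetric]])
  qed
qed

text \<open>Lebesgue measure is determined by its values on boxes. The preimage of a box under
  \<open>A\<close> is its image under the inverse \<open>B\<close>, whose factor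
  \<open>\<bar>det B\<bar>\<close> cancels against the density. As an identity of measures it serves
  all integrals at once.\<close>

lemma lborel_eq_density_distr_matrix:
  fixes A :: "real^'n^'n"
  assumes "det A \<noteq> 0"
  shows "(lborel :: (real^'n) measure) = density (distr lborel borel ((*v) A)) (\<lambda>_. ennreal \<bar>det A\<bar>)"
proof (rule lborel_eqI)
  obtain B where B: "A ** B = mat 1" "B ** A = mat 1"
    using assms invertible_det_nz[of A] unfolding invertible_def by blast
  have detB: "det A * det B = 1"
    using B(1) by (metis det_I det_mul)
  have AB: "A *v (B *v x) = x" "B *v (A *v x) = x" for x
    using B by (simp_all add: matrix_vector_mul_assoc)
  have meas: "(*v) A \<in> borel_measurable borel"
    by (intro borel_measurable_continuous_onI matrix_vector_mult_linear_continuous_on)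
  fix l u :: "real^'n"
  assume lu: "\<And>b. b \<in> Basis \<Longrightarrow> l \<bullet> b \<le> u \<bullet> b"
  have vimage: "(*v) A -` box l u = (*v) B ` box l u"
  proof (intro equalityI subsetI)
    fix x assume "x \<in> (*v) A -` box l u"
    then have "A *v x \<in> box l u" "x = B *v (A *v x)" by (simp_all add: AB)
    then show "x \<in> (*v) B ` box l u" by blast
  qed (auto simp: AB)
  have "box l u \<in> lmeasurable" by simp
  then have m: "(*v) A -` box l u \<in> lmeasurable"
    "measure lebesgue ((*v) A -` box l u) = \<bar>det B\<bar> * measure lebesgue (box l u)"
    using measure_linear_image_finite[of "(*v) B"] by (simp_all add: vimage)
  have bor: "(*v) A -` box l u \<in> sets borel"
    using measurable_sets[OF meas, of "box l u"] by simp
  have "emeasure lborel ((*v) A -` box l u) = emeasure lebesgue ((*v) A -` box l u)"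
    using bor by simp
  also have "\<dots> = ennreal (\<bar>det B\<bar> * measure lebesgue (box l u))"
    using m by (metis emeasure_eq_measure2)
  finally have e: "emeasure lborel ((*v) A -` box l u) = ennreal (\<bar>det B\<bar> * measure lborel (box l u))"
    by simp
  have "emeasure (density (distr lborel borel ((*v) A)) (\<lambda>_. ennreal \<bar>det A\<bar>)) (box l u) =
      ennreal \<bar>det A\<bar> * emeasure lborel ((*v) A -` box l u)"
    using meas by (simp add: emeasure_density_const emeasure_distr)
  also have "\<dots> = ennreal (\<bar>det A * det B\<bar> * measure lborel (box l u))"
    by (simp add: e ennreal_mult[symmetric] abs_mult mult.assoc)
  finally show "emeasure (density (distr lborel borel ((*v) A)) (\<lambda>_. ennreal \<bar>det A\<bar>)) (box l u) =
      (\<Prod>b\<in>Basis. (u - l) \<bullet> b)"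
    using lu by (simp add: detB measure_lborel_box_eq)
qed simp

lemma measurable_matrix_vector_mult [measurable]: "(*v) (A :: real^'n^'m) \<in> borel_measurable borel"
  by (intro borel_measurable_continuous_onI matrix_vector_mult_linear_continuous_on)

lemma nn_integral_matrix_change_of_variables:
  fixes A :: "real^'n^'n" and f :: "real^'n \<Rightarrow> ennreal"
  assumes "det A \<noteq> 0" and [measurable]: "f \<in> borel_measurable borel"
  shows "(\<integral>\<^sup>+x. f x \<partial>lborel) = ennreal \<bar>det A\<bar> * (\<integral>\<^sup>+x. f (A *v x) \<partial>lborel)"
  by (subst lborel_eq_density_distr_matrix[OF assms(1)])
    (simp add: nn_integral_density nn_integral_distr nn_integral_cmult)

lemma integral_matrix_change_of_variables:
  fixes A :: "real^'n^'n" and f :: "real^'n \<Rightarrow> 'a :: {banach, second_countable_topology}"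
  assumes "det A \<noteq> 0" and [measurable]: "f \<in> borel_measurable borel"
  shows "(\<integral>x. f x \<partial>lborel) = \<bar>det A\<bar> *\<^sub>R (\<integral>x. f (A *v x) \<partial>lborel)"
  by (subst lborel_eq_density_distr_matrix[OF assms(1)])
    (simp add: integral_density integral_distr)

lemma integrable_matrix_change_of_variables:
  fixes A :: "real^'n^'n" and f :: "real^'n \<Rightarrow> 'a :: {banach, second_countable_topology}"
  assumes "det A \<noteq> 0" and f: "integrable lborel f"
  shows "integrable lborel (\<lambda>x. f (A *v x))"
proof -
  have [measurable]: "f \<in> borel_measurable borel"
    using f by auto
  have "ennreal \<bar>det A\<bar> * (\<integral>\<^sup>+x. ennreal (norm (f (A *v x))) \<partial>lborel) < \<infinity>"
    using f nn_integral_matrix_change_of_variables[OF assms(1), of "\<lambda>x. ennreal (norm (f x))"]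
    by (simp add: integrable_iff_bounded)
  then show ?thesis
    using assms(1) by (auto simp: integrable_iff_bounded ennreal_mult_less_top)
qed

section \<open>The dilation group of a homogeneous function\<close>

lemma norm_matrix_vector_mult_le_entry_bound:
  fixes A :: "real^'n^'n"
  assumes "\<And>i j. \<bar>A $ i $ j\<bar> \<le> K"
  shows "norm (A *v x) \<le> (real CARD('n))\<^sup>2 * K * norm x"
proof -
  have "\<bar>(A *v x) $ i\<bar> \<le> real CARD('n) * (K * norm x)" for i
  proof -
    have "\<bar>(A *v x) $ i\<bar> \<le> (\<Sum>j\<in>UNIV. \<bar>A $ i $ j * x $ j\<bar>)"
      by (simp add: matrix_vector_mult_def sum_abs)
    also have "\<dots> \<le> (\<Sum>j\<in>(UNIV::'n set). K * norm x)"
      unfolding abs_mult using assms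
      by (intro sum_mono mult_mono) (auto intro: component_le_norm_cart order_trans[OF abs_ge_zero])
    finally show ?thesis by simp
  qed
  then have "(\<Sum>i\<in>UNIV. \<bar>(A *v x) $ i\<bar>) \<le> (\<Sum>i\<in>(UNIV::'n set). real CARD('n) * (K * norm x))"
    by (intro sum_mono)
  with norm_le_l1_cart[of "A *v x"] show ?thesis
    by (simp add: power2_eq_square algebra_simps)
qed

lemma abs_det_le_entry_bound:
  fixes A :: "real^'n^'n"
  assumes "\<And>i j. \<bar>A $ i $ j\<bar> \<le> K"
  shows "\<bar>det A\<bar> \<le> fact CARD('n) * K ^ CARD('n)"
proof -
  have "\<bar>det A\<bar> \<le> (\<Sum>p | p permutes (UNIV :: 'n set). \<bar>of_int (sign p) * (\<Prod>i\<in>UNIV. A $ i $ p i)\<bar>)"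
    unfolding det_def by (rule sum_abs)
  also have "\<dots> \<le> (\<Sum>p | p permutes (UNIV :: 'n set). K ^ CARD('n))"
  proof (intro sum_mono)
    fix p :: "'n \<Rightarrow> 'n"
    have "\<bar>of_int (sign p) * (\<Prod>i\<in>UNIV. A $ i $ p i)\<bar> = (\<Prod>i\<in>UNIV. \<bar>A $ i $ p i\<bar>)"
      by (simp add: abs_mult sign_def abs_prod)
    also have "\<dots> \<le> (\<Prod>i\<in>(UNIV::'n set). K)"
      using assms by (intro prod_mono) auto
    finally show "\<bar>of_int (sign p) * (\<Prod>i\<in>UNIV. A $ i $ p i)\<bar> \<le> K ^ CARD('n)" by simp
  qed
  finally show ?thesis by (simp add: card_permutations[OF refl])
qed

lemma continuous_on_mexp_entry: "continuous_on X (\<lambda>s. mexp (s *\<^sub>R A) $ i $ j)"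
  by (intro continuous_at_imp_continuous_on ballI DERIV_isCont[OF mexp_entry_has_derivative])

lemma continuous_on_mexp_mult [continuous_intros]:
  fixes A :: "real^'n^'n"
  assumes "continuous_on X f" "continuous_on X g"
  shows "continuous_on X (\<lambda>x. mexp (f x *\<^sub>R A) *v g x)"
proof -
  have "continuous_on X (\<lambda>x. mexp (f x *\<^sub>R A) $ i $ j)" for i j
    using continuous_on_compose2[OF continuous_on_mexp_entry[of UNIV] assms(1)] by simp
  then show ?thesis
    unfolding matrix_vector_mult_def
    by (intro continuous_on_vec_lambda continuous_on_sum continuous_on_mult
        continuous_on_component[OF assms(2)])
qed

lemma measurable_mexp_mult [measurable]:
  fixes A :: "real^'n^'n"
  assumes "f \<in> borel_measurable M" "g \<in> borel_measurable M"
  shows "(\<lambda>x. mexp (f x *\<^sub>R A) *v g x) \<in> borel_measurable M"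
  by (rule borel_measurable_continuous_Pair[OF assms])
    (intro continuous_intros)

lemma inner_mexp_has_derivative:
  fixes A :: "real^'n^'n"
  shows "((\<lambda>s. x \<bullet> (mexp (s *\<^sub>R A) *v \<eta>)) has_real_derivative
    (transpose A *v x) \<bullet> (mexp (s *\<^sub>R A) *v \<eta>)) (at s)"
proof -
  have "((\<lambda>s. \<Sum>i\<in>UNIV. x $ i * (\<Sum>j\<in>UNIV. mexp (s *\<^sub>R A) $ i $ j * \<eta> $ j)) has_real_derivative
      (\<Sum>i\<in>UNIV. x $ i * (\<Sum>j\<in>UNIV. (A ** mexp (s *\<^sub>R A)) $ i $ j * \<eta> $ j))) (at s)"
    by (intro DERIV_sum DERIV_cmult DERIV_cmult_right mexp_entry_has_derivative)
  then have "((\<lambda>s. x \<bullet> (mexp (s *\<^sub>R A) *v \<eta>)) has_real_derivative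
      x \<bullet> ((A ** mexp (s *\<^sub>R A)) *v \<eta>)) (at s)"
    unfolding matrix_vector_mult_def[of "mexp _"] matrix_vector_mult_def[of "A ** mexp _"]
    by (simp add: inner_vec_def)
  then show ?thesis
    by (simp only: transpose_matrix_vector dot_lmul_matrix matrix_vector_mul_assoc)
qed

text \<open>One exponent \<open>E\<close> is fixed, and dilations carry the additive parameter
  \<open>s = ln t\<close>, which makes them a flow to differentiate. The sign of \<open>Q\<close> is
  retained because the phase needs it. Different exponents of the same \<open>Q\<close> are compared
  by interpreting the locale twice.\<close>

locale homogeneous_function =
  fixes Q :: "real^'n \<Rightarrow> real" and E :: "real^'n^'n"
  assumes cont: "continuous_on UNIV Q"
    and eq_0: "Q \<xi> = 0 \<Longrightarrow> \<xi> = 0"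
    and homogeneous: "Q (mexp (s *\<^sub>R E) *v \<xi>) = exp s * Q \<xi>"
    and compact_level: "compact {\<xi>. \<bar>Q \<xi>\<bar> = 1}"
begin

abbreviation T :: "real \<Rightarrow> real^'n^'n" where "T s \<equiv> mexp (s *\<^sub>R E)"

abbreviation \<mu> :: real where "\<mu> \<equiv> trace E"

lemma T_minus_T [simp]: "T s *v (T (- s) *v \<xi>) = \<xi>" "T (- s) *v (T s *v \<xi>) = \<xi>"
  by (simp_all add: matrix_vector_mul_assoc)

lemma det_T [simp]: "det (T s) = exp (s * \<mu>)"
  by (rule det_mexp)

lemma Q_0 [simp]: "Q 0 = 0"
  using homogeneous[of 1 0] by simp

lemma Q_eq_0_iff [simp]: "Q \<xi> = 0 \<longleftrightarrow> \<xi> = 0"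
  using eq_0 by auto

lemma continuous_on_Q [continuous_intros]: "continuous_on X f \<Longrightarrow> continuous_on X (\<lambda>x. Q (f x))"
  using continuous_on_compose2[OF cont] by blast

lemma measurable_Q [measurable]: "Q \<in> borel_measurable borel"
  using cont by (rule borel_measurable_continuous_onI)

text \<open>Let a ball of radius \<open>R\<close> contain the level set and let \<open>M\<close>
  bound \<open>\<bar>Q\<bar>\<close> on it. A point of the sublevel set outside the ball flows to a
  point with \<open>\<bar>Q\<bar>\<close> above both \<open>M\<close> and 1, again outside the ball.
  A connected set joining the two outside the ball would contain a point with
  \<open>\<bar>Q\<bar> = 1\<close>, which is absurd.\<close>

lemma bounded_sublevel_1: "bounded {\<xi>. \<bar>Q \<xi>\<bar> \<le> 1}"
proof -
  obtain R where R: "R > 0" "\<And>\<xi>. \<bar>Q \<xi>\<bar> = 1 \<Longrightarrow> norm \<xi> \<le> R"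
    using compact_imp_bounded[OF compact_level] unfolding bounded_pos by auto
  obtain M where M: "\<And>\<xi>. norm \<xi> \<le> R \<Longrightarrow> \<bar>Q \<xi>\<bar> \<le> M"
  proof -
    have "compact (Q ` cball 0 R)"
      by (intro compact_continuous_image continuous_intros) simp
    from compact_imp_bounded[OF this] obtain M where "\<forall>\<xi>\<in>cball 0 R. \<bar>Q \<xi>\<bar> \<le> M"
      unfolding bounded_iff by auto
    then show ?thesis
      by (intro that[of M]) auto
  qed
  have "norm \<xi> \<le> R" if "\<bar>Q \<xi>\<bar> \<le> 1" for \<xi>
  proof (rule ccontr)
    assume far: "\<not> norm \<xi> \<le> R"
    then have "\<xi> \<noteq> 0" using R(1) by auto
    have less: "\<bar>Q \<xi>\<bar> < 1"
      using far R(2)[of \<xi>] that by force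
    \<comment> \<open>The time at which the orbit of \<open>\<xi>\<close> reaches the level
      \<open>\<bar>M\<bar> + 2\<close>, larger than both \<open>M\<close> and 1.\<close>
    define s where "s = ln ((\<bar>M\<bar> + 2) / \<bar>Q \<xi>\<bar>)"
    define \<zeta> where "\<zeta> = T s *v \<xi>"
    have "\<bar>Q \<zeta>\<bar> = \<bar>M\<bar> + 2"
      using \<open>\<xi> \<noteq> 0\<close> by (simp add: \<zeta>_def homogeneous s_def abs_mult)
    then have large: "\<bar>Q \<zeta>\<bar> > 1" and far': "norm \<zeta> > R"
      using M[of \<zeta>] by (auto simp: not_le[symmetric])
    have "\<exists>C. connected C \<and> \<xi> \<in> C \<and> \<zeta> \<in> C \<and> C \<subseteq> - cball 0 R"
    proof (cases "CARD('n) = 1")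
      case False
      then have "2 \<le> CARD('n)"
        using zero_less_card_finite[where 'a = 'n] by linarith
      then have "2 \<le> DIM(real^'n)" by simp
      then have "connected (- cball (0 :: real^'n) R)"
        by (intro connected_complement_bounded_convex) auto
      then show ?thesis
        using far far' by (intro exI[of _ "- cball 0 R"]) auto
    next
      case True
      then obtain i :: 'n where i: "UNIV = {i}" by (rule card_1_singletonE)
      define c where "c = T s $ i $ i"
      have all: "j = i" for j using i by blast
      \<comment> \<open>On the line the complement of the ball has two components. Being a square,
        the scalar \<open>T s\<close> is nonnegative, so \<open>\<zeta>\<close> stays on the ray of
        \<open>\<xi>\<close> and a half-line connects them.\<close>
      have "T s = T (s / 2) ** T (s / 2)"
        using mexp_add[of "s / 2" "s / 2" E] by simp
      then have "c = (T (s / 2) $ i $ i)\<^sup>2"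
        unfolding c_def by (simp add: matrix_matrix_mult_def i power2_eq_square)
      then have "c \<ge> 0" by simp
      have \<zeta>: "\<zeta> = c *\<^sub>R \<xi>"
        by (simp add: vec_eq_iff \<zeta>_def matrix_vector_mult_def i c_def) (metis all)
      let ?C = "(\<lambda>c. c *\<^sub>R \<xi>) ` {R / norm \<xi><..}"
      have "connected ?C"
        by (intro connected_continuous_image continuous_intros convex_connected) simp
      moreover have "?C \<subseteq> - cball 0 R"
      proof
        fix y assume "y \<in> ?C"
        then obtain d where d: "y = d *\<^sub>R \<xi>" "d > R / norm \<xi>" by auto
        moreover have "R / norm \<xi> > 0" using R(1) \<open>\<xi> \<noteq> 0\<close> by simp
        ultimately have "d > 0" by linarith
        with d \<open>\<xi> \<noteq> 0\<close> have "norm y = d * norm \<xi>" "d * norm \<xi> > R"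
          by (auto simp: field_simps)
        then show "y \<in> - cball 0 R" by simp
      qed
      moreover have "\<xi> \<in> ?C" "\<zeta> \<in> ?C"
        using far far' \<open>\<xi> \<noteq> 0\<close> \<open>c \<ge> 0\<close> unfolding \<zeta>
        by (auto simp: field_simps intro!: image_eqI[of _ _ 1])
      ultimately show ?thesis by blast
    qed
    then obtain C where C: "connected C" "\<xi> \<in> C" "\<zeta> \<in> C" "C \<subseteq> - cball 0 R" by blast
    have "connected ((\<lambda>\<xi>. \<bar>Q \<xi>\<bar>) ` C)"
      using C(1) by (intro connected_continuous_image continuous_intros)
    then have "1 \<in> (\<lambda>\<xi>. \<bar>Q \<xi>\<bar>) ` C"
      by (rule connectedD_interval[of _ "\<bar>Q \<xi>\<bar>" "\<bar>Q \<zeta>\<bar>"]) (use C less large in auto)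
    then obtain \<theta> where "\<theta> \<in> C" "\<bar>Q \<theta>\<bar> = 1" by auto
    with R(2)[of \<theta>] C(4) show False by auto
  qed
  then show ?thesis unfolding bounded_iff by blast
qed

text \<open>A ball of radius \<open>r\<close> lies in the unit sublevel set, the backward flow
  decreases \<open>\<bar>Q\<bar>\<close>, and that set lies in a ball of radius \<open>R\<close>.
  Linearity extends the bound from vectors of length \<open>r / 2\<close> to all vectors, whence
  \<open>2 * R / r\<close>.\<close>

lemma T_contracting:
  obtains C where "C > 0" "\<And>s \<xi>. s \<ge> 0 \<Longrightarrow> norm (T (- s) *v \<xi>) \<le> C * norm \<xi>"
proof -
  obtain R where R: "R > 0" "\<And>\<xi>. \<bar>Q \<xi>\<bar> \<le> 1 \<Longrightarrow> norm \<xi> \<le> R"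
    using bounded_sublevel_1 unfolding bounded_pos by auto
  have "isCont Q 0"
    using cont by (simp add: continuous_on_eq_continuous_at)
  then obtain r where r: "r > 0" "\<And>\<xi>. norm \<xi> < r \<Longrightarrow> \<bar>Q \<xi>\<bar> < 1"
    using continuous_at_eps_delta[of 0 Q] by (metis Q_0 diff_zero dist_norm dist_real_def zero_less_one)
  show ?thesis
  proof (rule that[of "2 * R / r"])
    fix s :: real and \<xi> :: "real^'n"
    assume "s \<ge> 0"
    show "norm (T (- s) *v \<xi>) \<le> 2 * R / r * norm \<xi>"
    proof (cases "\<xi> = 0")
      case False
      define c where "c = r / (2 * norm \<xi>)"
      have c: "c > 0" "norm (c *\<^sub>R \<xi>) < r"
        using False r(1) by (auto simp: c_def)
      have "\<bar>Q (T (- s) *v (c *\<^sub>R \<xi>))\<bar> \<le> 1 * 1"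
        unfolding homogeneous abs_mult using r(2)[OF c(2)] \<open>s \<ge> 0\<close> by (intro mult_mono) auto
      then have "norm (T (- s) *v (c *\<^sub>R \<xi>)) \<le> R" by (intro R(2)) simp
      then have "c * norm (T (- s) *v \<xi>) \<le> R"
        using c(1) by (simp add: matrix_vector_mult_scaleR)
      with c(1) have "norm (T (- s) *v \<xi>) \<le> R / c" by (simp add: field_simps)
      then show ?thesis by (simp add: c_def algebra_simps)
    qed simp
  qed (use R r in auto)
qed

text \<open>By Cramer's rule \<open>T s\<close> is \<open>det (T s)\<close> times the adjugate of the bounded matrix \<open>T (- s)\<close>.\<close>

lemma T_growth:
  obtains C where "C > 0" "\<And>s \<xi>. s \<ge> 0 \<Longrightarrow> norm (T s *v \<xi>) \<le> C * exp (\<mu> * s) * norm \<xi>"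
proof -
  obtain C where C: "C > 0" "\<And>s \<xi>. s \<ge> 0 \<Longrightarrow> norm (T (- s) *v \<xi>) \<le> C * norm \<xi>"
    using T_contracting by blast
  \<comment> \<open>The maximum with 1 also covers the column that Cramer's rule replaces by a unit
    vector.\<close>
  define K where "K = max C 1"
  define L where "L = fact CARD('n) * K ^ CARD('n)"
  have "L > 0" unfolding L_def K_def by simp
  have entry: "\<bar>T (- s) $ i $ j\<bar> \<le> K" if "s \<ge> 0" for s i j
  proof -
    have "\<bar>T (- s) $ i $ j\<bar> = \<bar>(T (- s) *v axis j 1) $ i\<bar>"
      by (simp add: matrix_vector_mult_basis column_def)
    also have "\<dots> \<le> norm (T (- s) *v axis j 1)" by (rule component_le_norm_cart)
    also have "\<dots> \<le> C" using C(2)[OF that, of "axis j 1"] by simp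
    finally show ?thesis by (simp add: K_def)
  qed
  have "\<bar>T s $ k $ l\<bar> \<le> L * exp (\<mu> * s)" if "s \<ge> 0" for s k l
  proof -
    let ?b = "axis l 1 :: real^'n"
    let ?B = "\<chi> i j. if j = k then ?b $ i else T (- s) $ i $ j"
    have "T s *v ?b = (\<chi> k. det (\<chi> i j. if j = k then ?b $ i else T (- s) $ i $ j) / det (T (- s)))"
      by (subst cramer[symmetric]) (simp_all del: scaleR_minus_left)
    then have "T s $ k $ l = det ?B / det (T (- s))"
      by (simp add: matrix_vector_mult_basis column_def vec_eq_iff)
    also have "\<dots> = det ?B * exp (\<mu> * s)"
      unfolding det_T by (simp add: exp_minus field_simps)
    finally have eq: "\<bar>T s $ k $ l\<bar> = \<bar>det ?B\<bar> * exp (\<mu> * s)" by (simp add: abs_mult)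
    have "\<bar>det ?B\<bar> \<le> L"
      unfolding L_def
    proof (rule abs_det_le_entry_bound)
      fix i j
      have "\<bar>?b $ i\<bar> \<le> K" by (simp add: axis_def K_def max_def)
      with entry[OF that, of i j] show "\<bar>?B $ i $ j\<bar> \<le> K" by simp
    qed
    then show ?thesis unfolding eq by (intro mult_right_mono) auto
  qed
  then have "norm (T s *v \<xi>) \<le> (real CARD('n))\<^sup>2 * L * exp (\<mu> * s) * norm \<xi>" if "s \<ge> 0" for s \<xi>
    using norm_matrix_vector_mult_le_entry_bound[of "T s" "L * exp (\<mu> * s)" \<xi>] that
    by (simp add: mult.assoc)
  with \<open>L > 0\<close> show ?thesis by (intro that[of "(real CARD('n))\<^sup>2 * L"]) auto
qed

end

section \<open>Volumes and polar coordinates\<close>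

context homogeneous_function
begin

lemma bounded_sublevel: "bounded {\<xi>. \<bar>Q \<xi>\<bar> < r}"
proof (cases "r > 0")
  case True
  have "{\<xi>. \<bar>Q \<xi>\<bar> < r} \<subseteq> (\<lambda>\<xi>. T (ln r) *v \<xi>) ` {\<xi>. \<bar>Q \<xi>\<bar> \<le> 1}"
  proof
    fix \<xi> assume "\<xi> \<in> {\<xi>. \<bar>Q \<xi>\<bar> < r}"
    then have "T (- ln r) *v \<xi> \<in> {\<xi>. \<bar>Q \<xi>\<bar> \<le> 1}" "\<xi> = T (ln r) *v (T (- ln r) *v \<xi>)"
      using True by (simp_all add: homogeneous abs_mult exp_minus field_simps del: scaleR_minus_left)
    then show "\<xi> \<in> (\<lambda>\<xi>. T (ln r) *v \<xi>) ` {\<xi>. \<bar>Q \<xi>\<bar> \<le> 1}" by blast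
  qed
  moreover have "bounded ((\<lambda>\<xi>. T (ln r) *v \<xi>) ` {\<xi>. \<bar>Q \<xi>\<bar> \<le> 1})"
    using bounded_linear_image[OF bounded_sublevel_1 matrix_vector_mul_bounded_linear] .
  ultimately show ?thesis using bounded_subset by blast
next
  case False
  then have "{\<xi>. \<bar>Q \<xi>\<bar> < r} = {}" by auto
  then show ?thesis by (metis bounded_empty)
qed

lemma open_sublevel: "open {\<xi>. \<bar>Q \<xi>\<bar> < r}"
  by (intro open_Collect_less continuous_intros)

lemma sublevel_sets [measurable]: "{\<xi>. \<bar>Q \<xi>\<bar> < r} \<in> sets borel"
  using open_sublevel by simp

lemma emeasure_sublevel_finite: "emeasure lborel {\<xi>. \<bar>Q \<xi>\<bar> < r} < \<infinity>"
  by (rule emeasure_bounded_finite[OF bounded_sublevel])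

lemma emeasure_sublevel_exp:
  "emeasure lborel {\<xi>. \<bar>Q \<xi>\<bar> < exp s * r} = ennreal (exp (s * \<mu>)) * emeasure lborel {\<xi>. \<bar>Q \<xi>\<bar> < r}"
proof -
  have "emeasure lborel {\<xi>. \<bar>Q \<xi>\<bar> < exp s * r} =
      ennreal (exp (s * \<mu>)) * (\<integral>\<^sup>+\<xi>. indicator {\<xi>. \<bar>Q \<xi>\<bar> < exp s * r} (T s *v \<xi>) \<partial>lborel)"
    using nn_integral_matrix_change_of_variables[of "T s" "indicator {\<xi>. \<bar>Q \<xi>\<bar> < exp s * r}"]
    by simp
  also have "(\<lambda>\<xi>. indicator {\<xi>. \<bar>Q \<xi>\<bar> < exp s * r} (T s *v \<xi>) :: ennreal) =
      indicator {\<xi>. \<bar>Q \<xi>\<bar> < r}"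
    by (auto simp: fun_eq_iff homogeneous abs_mult indicator_def)
  finally show ?thesis by simp
qed

lemma measure_sublevel_1_pos: "measure lborel {\<xi>. \<bar>Q \<xi>\<bar> < 1} > 0"
proof -
  have "emeasure lborel {\<xi>. \<bar>Q \<xi>\<bar> < 1} \<noteq> 0"
  proof
    assume "emeasure lborel {\<xi>. \<bar>Q \<xi>\<bar> < 1} = 0"
    then have "negligible {\<xi>. \<bar>Q \<xi>\<bar> < 1}"
      using sublevel_sets[of 1] by (simp add: negligible_iff_null_sets null_sets_def)
    then have "{\<xi>. \<bar>Q \<xi>\<bar> < 1} = {}"
      using open_sublevel open_not_negligible by blast
    moreover have "0 \<in> {\<xi>. \<bar>Q \<xi>\<bar> < 1}" by simp
    ultimately show False by blast
  qed
  then show ?thesis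
    using emeasure_sublevel_finite[of 1] by (simp add: measure_def enn2real_positive_iff zero_less_iff_neq_zero)
qed

lemma measure_sublevel_exp:
  "measure lborel {\<xi>. \<bar>Q \<xi>\<bar> < exp s} = exp (s * \<mu>) * measure lborel {\<xi>. \<bar>Q \<xi>\<bar> < 1}"
  using emeasure_sublevel_exp[of s 1] by (simp add: measure_def enn2real_mult)

text \<open>Otherwise the sublevel sets at \<open>exp (real n)\<close>, which exhaust the space,
  would all have at most the finite volume of the unit one.\<close>

lemma \<mu>_pos: "\<mu> > 0"
proof (rule ccontr)
  assume "\<not> \<mu> > 0"
  let ?B = "\<lambda>n::nat. {\<xi>. \<bar>Q \<xi>\<bar> < exp (real n)}"
  have "\<xi> \<in> ?B (nat \<lceil>\<bar>Q \<xi>\<bar>\<rceil>)" for \<xi>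
  proof -
    have "\<bar>Q \<xi>\<bar> \<le> real (nat \<lceil>\<bar>Q \<xi>\<bar>\<rceil>)" by (rule real_nat_ceiling_ge)
    with exp_ge_add_one_self[of "real (nat \<lceil>\<bar>Q \<xi>\<bar>\<rceil>)"] show ?thesis unfolding mem_Collect_eq by linarith
  qed
  then have UN: "(\<Union>n. ?B n) = UNIV" by blast
  have SUP: "(SUP n. emeasure lborel (?B n)) = emeasure lborel (\<Union>n. ?B n)"
    by (rule SUP_emeasure_incseq) (auto simp: incseq_def intro: less_le_trans)
  have le: "emeasure lborel (?B n) \<le> emeasure lborel {\<xi>. \<bar>Q \<xi>\<bar> < 1}" for n
  proof -
    have "emeasure lborel (?B n) \<le> 1 * emeasure lborel {\<xi>. \<bar>Q \<xi>\<bar> < 1}"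
      unfolding emeasure_sublevel_exp[of "real n" 1, unfolded mult_1_right]
      using \<open>\<not> \<mu> > 0\<close> by (intro mult_right_mono) (auto simp: mult_nonneg_nonpos)
    then show ?thesis by simp
  qed
  have "(SUP n. emeasure lborel (?B n)) \<le> emeasure lborel {\<xi>. \<bar>Q \<xi>\<bar> < 1}"
    by (rule SUP_least) (rule le)
  then have "emeasure lborel (UNIV :: (real^'n) set) \<le> emeasure lborel {\<xi>. \<bar>Q \<xi>\<bar> < 1}"
    unfolding SUP UN .
  with emeasure_sublevel_finite[of 1] show False
    by (simp add: top_unique)
qed

abbreviation shell :: "(real^'n) set" where "shell \<equiv> {\<eta>. 1 \<le> \<bar>Q \<eta>\<bar> \<and> \<bar>Q \<eta>\<bar> < exp 1}"

lemma shell_sets [measurable]: "shell \<in> sets borel"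
  by measurable

lemma integrable_indicator_shell: "integrable lborel (indicator shell :: real^'n \<Rightarrow> real)"
proof -
  have "emeasure lborel shell \<le> emeasure lborel {\<xi>. \<bar>Q \<xi>\<bar> < exp 1}"
    by (intro emeasure_mono) auto
  also have "\<dots> < \<infinity>" by (rule emeasure_sublevel_finite)
  finally show ?thesis
    by (intro integrable_real_indicator) auto
qed

text \<open>Polar coordinates with the shell \<open>1 \<le> \<bar>Q\<bar> < exp 1\<close> in place of a surface measure on \<open>\<bar>Q\<bar> = 1\<close>:
  every nonzero orbit of the flow \<open>T\<close> spends exactly unit time in the shell, so Fubini and the
  linear substitution \<open>\<xi> = T s *v \<eta>\<close> give the formula.\<close>

lemma polar_integral:
  fixes f :: "real^'n \<Rightarrow> 'a :: {banach, second_countable_topology}"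
  assumes f: "integrable lborel f"
  shows "(\<integral>\<xi>. f \<xi> \<partial>lborel) =
    (\<integral>\<eta>. indicator shell \<eta> *\<^sub>R (\<integral>s. exp (s * \<mu>) *\<^sub>R f (T s *v \<eta>) \<partial>lborel) \<partial>lborel)"
proof -
  have [measurable]: "f \<in> borel_measurable borel" using f by auto
  define g where "g \<xi> s = indicat_real shell (T (- s) *v \<xi>) *\<^sub>R f \<xi>" for \<xi> s
  define h where "h s \<eta> = indicat_real shell \<eta> *\<^sub>R exp (s * \<mu>) *\<^sub>R f (T s *v \<eta>)" for s \<eta>
  have [measurable]: "case_prod g \<in> borel_measurable (lborel \<Otimes>\<^sub>M lborel)"
    "case_prod h \<in> borel_measurable (lborel \<Otimes>\<^sub>M lborel)"
    unfolding g_def h_def by measurable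
  \<comment> \<open>The half-open shell corresponds to a half-open time interval of length 1, so the
    weight in \<open>g\<close> integrates to 1 in \<open>s\<close> for every nonzero
    \<open>\<xi>\<close>.\<close>
  have ind: "indicat_real shell (T (- s) *v \<xi>) = indicator {ln \<bar>Q \<xi>\<bar> - 1<..ln \<bar>Q \<xi>\<bar>} s" if "\<xi> \<noteq> 0" for s \<xi>
  proof -
    have "1 \<le> exp (- s) * \<bar>Q \<xi>\<bar> \<longleftrightarrow> s \<le> ln \<bar>Q \<xi>\<bar>"
      using that by (simp add: exp_minus field_simps ln_ge_iff)
    moreover have "exp (- s) * \<bar>Q \<xi>\<bar> < exp 1 \<longleftrightarrow> ln \<bar>Q \<xi>\<bar> < 1 + s"
      using that ln_ge_iff[of "\<bar>Q \<xi>\<bar>" "1 + s"]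
      by (simp add: exp_minus exp_add field_simps not_le[symmetric])
    ultimately show ?thesis
      by (auto simp: indicator_def homogeneous abs_mult simp del: scaleR_minus_left)
  qed
  have AE0: "AE \<xi> in lborel. (\<xi> :: real^'n) \<noteq> 0"
    by (rule AE_lborel_singleton)
  have g_int: "integrable (lborel \<Otimes>\<^sub>M lborel) (case_prod g)"
  proof (rule lborel_pair.Fubini_integrable)
    have "norm (f \<xi>) = (\<integral>s. norm (g \<xi> s) \<partial>lborel)" if "\<xi> \<noteq> 0" for \<xi>
      using that by (simp add: g_def ind del: scaleR_minus_left)
    then have "AE \<xi> in lborel. norm (f \<xi>) = (\<integral>s. norm (g \<xi> s) \<partial>lborel)"
      using AE0 by (auto elim: eventually_mono)
    from integrable_cong_AE_imp[OF integrable_norm[OF f] _ this]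
    show "integrable lborel (\<lambda>\<xi>. \<integral>s. norm (case_prod g (\<xi>, s)) \<partial>lborel)" by simp
    show "AE \<xi> in lborel. integrable lborel (\<lambda>s. case_prod g (\<xi>, s))"
      using AE0 by eventually_elim (simp add: g_def ind del: scaleR_minus_left)
  qed simp
  \<comment> \<open>The map \<open>F\<close> is used twice: as the norm for the integrability of
    \<open>h\<close>, as the identity for the exchange of integrals.\<close>
  have g_h: "(\<integral>\<xi>. F (g \<xi> s) \<partial>lborel) = (\<integral>\<eta>. exp (s * \<mu>) *\<^sub>R F (indicator shell \<eta> *\<^sub>R f (T s *v \<eta>)) \<partial>lborel)"
    if [measurable]: "F \<in> borel_measurable borel" for F :: "'a \<Rightarrow> 'b :: {banach, second_countable_topology}" and s
    using integral_matrix_change_of_variables[of "T s" "\<lambda>\<xi>. F (g \<xi> s)"]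
    by (simp add: g_def del: scaleR_minus_left)
  have h_int: "integrable (lborel \<Otimes>\<^sub>M lborel) (case_prod h)"
  proof (rule lborel_pair.Fubini_integrable)
    have "(\<integral>\<eta>. norm (h s \<eta>) \<partial>lborel) = (\<integral>\<xi>. norm (g \<xi> s) \<partial>lborel)" for s
      by (subst g_h) (simp_all add: h_def ac_simps)
    moreover have "integrable lborel (\<lambda>s. \<integral>\<xi>. norm (g \<xi> s) \<partial>lborel)"
      using lborel_pair.integrable_snd[of "\<lambda>\<xi> s. norm (g \<xi> s)"] integrable_norm[OF g_int]
      by (simp add: case_prod_unfold)
    ultimately show "integrable lborel (\<lambda>s. \<integral>\<eta>. norm (case_prod h (s, \<eta>)) \<partial>lborel)" by simp
    have "AE s in lborel. integrable lborel (\<lambda>\<xi>. g \<xi> s)"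
      using lborel_pair.AE_integrable_snd[OF g_int] .
    then show "AE s in lborel. integrable lborel (\<lambda>\<eta>. case_prod h (s, \<eta>))"
    proof eventually_elim
      case (elim s)
      from integrable_scaleR_right[OF integrable_matrix_change_of_variables[OF _ this, of "T s"], of "exp (s * \<mu>)"]
      show ?case by (simp add: h_def g_def mult.commute del: scaleR_minus_left)
    qed
  qed simp
  have "(\<integral>\<xi>. f \<xi> \<partial>lborel) = (\<integral>\<xi>. (\<integral>s. g \<xi> s \<partial>lborel) \<partial>lborel)"
    by (intro integral_cong_AE) (use AE0 in \<open>auto simp: g_def ind simp del: scaleR_minus_left elim!: eventually_mono\<close>)
  also have "\<dots> = (\<integral>s. (\<integral>\<xi>. g \<xi> s \<partial>lborel) \<partial>lborel)"
    by (rule lborel_pair.Fubini_integral[OF g_int, symmetric])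
  also have "\<dots> = (\<integral>s. (\<integral>\<eta>. h s \<eta> \<partial>lborel) \<partial>lborel)"
    using g_h[of "\<lambda>x. x"] by (simp add: h_def mult.commute)
  also have "\<dots> = (\<integral>\<eta>. (\<integral>s. h s \<eta> \<partial>lborel) \<partial>lborel)"
    by (rule lborel_pair.Fubini_integral[OF h_int, symmetric])
  finally show ?thesis by (simp only: h_def integral_scaleR_right)
qed

end

section \<open>Oscillatory integrals\<close>

text \<open>Integration by parts against \<open>exp (- \<i> \<phi>)\<close> with \<open>\<phi> s = t * q * exp s + \<psi> s\<close>, where \<open>\<psi>\<close> is a
  perturbation dominated by the leading term.\<close>

lemma oscillatory_integral_bound:
  fixes \<psi> \<psi>' \<psi>'' :: "real \<Rightarrow> real" and q t \<mu> a b :: real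
  assumes \<psi>: "\<And>s. (\<psi> has_real_derivative \<psi>' s) (at s)"
    and \<psi>': "\<And>s. (\<psi>' has_real_derivative \<psi>'' s) (at s)"
    and bound': "\<And>s. s \<ge> a \<Longrightarrow> \<bar>\<psi>' s\<bar> \<le> t / 2 * exp s"
    and bound'': "\<And>s. s \<ge> a \<Longrightarrow> \<bar>\<psi>'' s\<bar> \<le> t / 2 * exp s"
    and q: "1 \<le> \<bar>q\<bar>" "\<bar>q\<bar> \<le> 3" and "t > 0" and \<mu>: "0 \<le> \<mu>" "\<mu> < 1" and "a \<le> b"
  shows "norm (integral {a..b} (\<lambda>s. exp (s * \<mu>) *\<^sub>R exp (- \<i> * complex_of_real (t * (exp s * q) + \<psi> s))))
    \<le> 22 / ((1 - \<mu>) * t) * exp ((\<mu> - 1) * a)"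
proof -
  define \<phi> where "\<phi> s = t * (exp s * q) + \<psi> s" for s
  define \<phi>' where "\<phi>' s = t * (exp s * q) + \<psi>' s" for s
  define \<phi>'' where "\<phi>'' s = t * (exp s * q) + \<psi>'' s" for s
  define w where "w s = exp (s * \<mu>) / \<phi>' s" for s
  define w' where "w' s = (\<mu> * exp (s * \<mu>) * \<phi>' s - exp (s * \<mu>) * \<phi>'' s) / (\<phi>' s)\<^sup>2" for s
  define e where "e s = exp (- \<i> * complex_of_real (\<phi> s))" for s
  have norm_e: "norm (e s) = 1" for s
    by (simp add: e_def)
  \<comment> \<open>At least half of the leading term survives in \<open>\<phi>'\<close>, and
    \<open>\<phi>''\<close> is at most 3 + 1/2 times \<open>t * exp s\<close>, rounded up to 4. The
    3 majorizes \<open>exp 1\<close>, the outer level of the shell.\<close>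
  have lead: "t * exp s \<le> \<bar>t * (exp s * q)\<bar>" "\<bar>t * (exp s * q)\<bar> \<le> 3 * (t * exp s)" for s
    using q \<open>t > 0\<close> by (auto simp: abs_mult mult_left_mono)
  have \<phi>'_lower: "t / 2 * exp s \<le> \<bar>\<phi>' s\<bar>" if "s \<ge> a" for s
    using lead[of s] bound'[OF that] unfolding \<phi>'_def by linarith
  have \<phi>''_upper: "\<bar>\<phi>'' s\<bar> \<le> 4 * (t * exp s)" if "s \<ge> a" for s
    using lead[of s] bound''[OF that] mult_pos_pos[OF \<open>t > 0\<close> exp_gt_zero[of s]] unfolding \<phi>''_def by linarith
  have pos: "t / 2 * exp s > 0" for s using \<open>t > 0\<close> by simp
  have \<phi>'_nz: "\<phi>' s \<noteq> 0" if "s \<ge> a" for s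
    using \<phi>'_lower[OF that] pos[of s] by auto
  have exp_eq: "exp (s * \<mu>) / (t / 2 * exp s) = 2 / t * exp ((\<mu> - 1) * s)" for s
    using \<open>t > 0\<close> by (simp add: field_simps flip: exp_add)
  have w_bound: "\<bar>w s\<bar> \<le> 2 / t * exp ((\<mu> - 1) * s)" if "s \<ge> a" for s
  proof -
    have "\<bar>w s\<bar> \<le> exp (s * \<mu>) / (t / 2 * exp s)"
      unfolding w_def abs_divide using \<phi>'_lower[OF that] pos[of s] by (intro frac_le) auto
    then show ?thesis unfolding exp_eq .
  qed
  have w'_bound: "\<bar>w' s\<bar> \<le> 18 / t * exp ((\<mu> - 1) * s)" if "s \<ge> a" for s
  proof -
    \<comment> \<open>Factoring out \<open>w s\<close> leaves \<open>\<mu> \<le> 1\<close> and a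
      quotient of size at most 4 / (1/2) = 8, so that 18 = (1 + 8) * 2.\<close>
    have "w' s = \<mu> * w s - w s * (\<phi>'' s / \<phi>' s)"
      using \<phi>'_nz[OF that] by (simp add: w'_def w_def field_simps power2_eq_square)
    then have "\<bar>w' s\<bar> \<le> \<mu> * \<bar>w s\<bar> + \<bar>w s\<bar> * \<bar>\<phi>'' s / \<phi>' s\<bar>"
      using \<mu>(1) abs_triangle_ineq4[of "\<mu> * w s" "w s * (\<phi>'' s / \<phi>' s)"] by (simp add: abs_mult)
    also have "\<dots> \<le> 1 * \<bar>w s\<bar> + \<bar>w s\<bar> * 8"
    proof (intro add_mono mult_mono)
      have "\<bar>\<phi>'' s / \<phi>' s\<bar> \<le> (4 * (t * exp s)) / (t / 2 * exp s)"
        unfolding abs_divide using \<phi>'_lower[OF that] \<phi>''_upper[OF that] pos[of s] by (intro frac_le) auto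
      then show "\<bar>\<phi>'' s / \<phi>' s\<bar> \<le> 8" using \<open>t > 0\<close> by simp
    qed (use \<mu> in auto)
    also have "\<dots> \<le> 18 / t * exp ((\<mu> - 1) * s)" using w_bound[OF that] by simp
    finally show ?thesis .
  qed
  \<comment> \<open>The boundary term of the integration by parts: \<open>\<i> * e s\<close> has
    derivative \<open>\<phi>' s * e s\<close>, and multiplying by \<open>w s\<close> restores the
    amplitude \<open>exp (s * \<mu>)\<close>.\<close>
  define F where "F s = \<i> * e s * of_real (w s)" for s
  have d\<phi>: "(\<phi> has_real_derivative \<phi>' s) (at s)" for s
    unfolding \<phi>_def[abs_def] \<phi>'_def by (auto intro!: derivative_eq_intros \<psi>)
  have d\<phi>': "(\<phi>' has_real_derivative \<phi>'' s) (at s)" for s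
    unfolding \<phi>'_def[abs_def] \<phi>''_def by (auto intro!: derivative_eq_intros \<psi>')
  have dw: "(w has_real_derivative w' s) (at s)" if "s \<ge> a" for s
    unfolding w_def[abs_def] w'_def using \<phi>'_nz[OF that]
    by (auto intro!: derivative_eq_intros d\<phi>' simp: power2_eq_square)
  have de: "(e has_vector_derivative (- \<i> * of_real (\<phi>' s)) * e s) (at s)" for s
  proof -
    have "((\<lambda>s. - \<i> * complex_of_real (\<phi> s)) has_vector_derivative - \<i> * of_real (\<phi>' s)) (at s)"
      using has_vector_derivative_mult_right[OF has_vector_derivative_of_real[OF d\<phi>[of s]], of "- \<i>"] by simp
    from field_vector_diff_chain_at[OF this DERIV_exp]
    show ?thesis by (simp add: e_def[abs_def] o_def)
  qed
  define G where "G s = exp (s * \<mu>) *\<^sub>R e s" for s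
  have dF: "(F has_vector_derivative G s + \<i> * e s * of_real (w' s)) (at s)" if "s \<ge> a" for s
  proof -
    have "(F has_vector_derivative \<i> * e s * of_real (w' s) + \<i> * ((- \<i> * of_real (\<phi>' s)) * e s) * of_real (w s)) (at s)"
      unfolding F_def[abs_def]
      by (intro has_vector_derivative_mult has_vector_derivative_mult_right de has_vector_derivative_of_real dw that)
    moreover have "\<i> * ((- \<i> * of_real (\<phi>' s)) * e s) * of_real (w s) = G s"
    proof -
      have "\<phi>' s * w s = exp (s * \<mu>)" using \<phi>'_nz[OF that] by (simp add: w_def)
      then have "of_real (\<phi>' s) * of_real (w s) = complex_of_real (exp (s * \<mu>))"
        by (metis of_real_mult)
      then have "e s * (of_real (\<phi>' s) * of_real (w s)) = G s"
        by (simp add: G_def scaleR_conv_of_real)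
      then show ?thesis by (simp add: algebra_simps)
    qed
    ultimately show ?thesis by (simp only: add.commute)
  qed
  have FTC: "((\<lambda>s. G s + \<i> * e s * of_real (w' s)) has_integral F b - F a) {a..b}"
    using dF \<open>a \<le> b\<close>
    by (intro fundamental_theorem_of_calculus) (auto intro: has_vector_derivative_at_within)
  have "continuous_on {a..b} e"
    using de by (meson continuous_at_imp_continuous_on has_vector_derivative_continuous)
  then have G_int: "G integrable_on {a..b}"
    unfolding G_def by (intro integrable_continuous_real continuous_intros)
  have rest: "((\<lambda>s. \<i> * e s * of_real (w' s)) has_integral (F b - F a - integral {a..b} G)) {a..b}"
    using has_integral_diff[OF FTC integrable_integral[OF G_int]] by simp
  have eint: "((\<lambda>s. 18 / t * exp ((\<mu> - 1) * s)) has_integral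
      (18 / t * (exp ((\<mu> - 1) * b) / (\<mu> - 1)) - 18 / t * (exp ((\<mu> - 1) * a) / (\<mu> - 1)))) {a..b}"
    using \<mu> \<open>a \<le> b\<close> \<open>t > 0\<close>
    by (intro fundamental_theorem_of_calculus)
      (auto intro!: derivative_eq_intros simp flip: has_real_derivative_iff_has_vector_derivative)
  have "norm (F b - F a - integral {a..b} G) \<le> integral {a..b} (\<lambda>s. 18 / t * exp ((\<mu> - 1) * s))"
    unfolding integral_unique[OF rest, symmetric]
    by (rule integral_norm_bound_integral)
      (use rest eint w'_bound in \<open>auto simp: has_integral_integrable norm_mult norm_e\<close>)
  also have "\<dots> \<le> 18 / t * (exp ((\<mu> - 1) * a) / (1 - \<mu>))"
  proof -
    have "exp ((\<mu> - 1) * b) / (\<mu> - 1) \<le> 0" "exp ((\<mu> - 1) * a) / (\<mu> - 1) = - (exp ((\<mu> - 1) * a) / (1 - \<mu>))"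
      using \<mu> by (auto simp: divide_nonneg_neg field_simps)
    then show ?thesis
      unfolding integral_unique[OF eint] using \<open>t > 0\<close> mult_left_mono[of "exp ((\<mu> - 1) * b) / (\<mu> - 1)" 0 "18 / t"]
      by simp
  qed
  finally have n1: "norm (F b - F a - integral {a..b} G) \<le> 18 / t * (exp ((\<mu> - 1) * a) / (1 - \<mu>))" .
  have "exp ((\<mu> - 1) * b) \<le> exp ((\<mu> - 1) * a)"
    using \<mu> \<open>a \<le> b\<close> by (simp add: mult_left_mono_neg)
  then have n2: "norm (F a) \<le> 2 / t * exp ((\<mu> - 1) * a)" "norm (F b) \<le> 2 / t * exp ((\<mu> - 1) * a)"
    using w_bound[of a] order_trans[OF w_bound[of b] mult_left_mono, of "exp ((\<mu> - 1) * a)"] \<open>a \<le> b\<close> \<open>t > 0\<close>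
    by (auto simp: F_def norm_mult norm_e)
  have "integral {a..b} G = (F b - F a) - (F b - F a - integral {a..b} G)" by simp
  then have "norm (integral {a..b} G) \<le> norm (F b) + norm (F a) + norm (F b - F a - integral {a..b} G)"
    by (metis norm_triangle_ineq4 order_trans add_right_mono)
  also have "\<dots> \<le> 4 / t * exp ((\<mu> - 1) * a) + 18 / t * (exp ((\<mu> - 1) * a) / (1 - \<mu>))"
    using n1 n2 by simp
  \<comment> \<open>Because \<open>1 / (1 - \<mu>)\<close> is at least 1, the two boundary terms can
    be merged with the integral term: 4 + 18 = 22.\<close>
  also have "\<dots> \<le> 4 / t * (exp ((\<mu> - 1) * a) / (1 - \<mu>)) + 18 / t * (exp ((\<mu> - 1) * a) / (1 - \<mu>))"
    using \<mu> \<open>t > 0\<close> by (intro add_right_mono mult_left_mono) (auto simp: field_simps)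
  also have "\<dots> = 22 / ((1 - \<mu>) * t) * exp ((\<mu> - 1) * a)"
    unfolding distrib_right[symmetric] add_divide_distrib[symmetric] by (simp add: mult.commute)
  finally show ?thesis unfolding G_def e_def \<phi>_def .
qed

section \<open>Decay of the tail of the integral beyond a level of \<open>Q\<close>\<close>

context homogeneous_function
begin

text \<open>The two vectors paired with \<open>T s *v \<eta>\<close> are those produced by
  differentiating \<open>x \<bullet> (T s *v \<eta>)\<close> once and twice, so both pairings are at
  most a constant times \<open>exp (\<mu> * s)\<close>. The time \<open>s0\<close> is chosen before
  \<open>t\<close>, \<open>x\<close> and \<open>\<eta>\<close>, and all later uniformity rests on
  that.\<close>

lemma phase_bounds:
  fixes X t0 :: real
  assumes "\<mu> < 1" "t0 > 0"
  obtains s0 where "s0 \<ge> 0"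
    "\<And>s t x \<eta>. s \<ge> s0 \<Longrightarrow> t \<ge> t0 \<Longrightarrow> norm x \<le> X \<Longrightarrow> \<eta> \<in> shell \<Longrightarrow>
       \<bar>(transpose E *v x) \<bullet> (T s *v \<eta>)\<bar> \<le> t / 2 * exp s \<and>
       \<bar>(transpose E *v (transpose E *v x)) \<bullet> (T s *v \<eta>)\<bar> \<le> t / 2 * exp s"
proof -
  obtain C where C: "C > 0" "\<And>s \<xi>. s \<ge> 0 \<Longrightarrow> norm (T s *v \<xi>) \<le> C * exp (\<mu> * s) * norm \<xi>"
    using T_growth by blast
  obtain R where R: "R > 0" "\<And>\<eta>. \<eta> \<in> shell \<Longrightarrow> norm \<eta> \<le> R"
    using bounded_sublevel[of "exp 1"] unfolding bounded_pos by auto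
  obtain B where B: "B > 0" "\<And>x. norm (transpose E *v x) \<le> B * norm x"
    using bounded_linear.pos_bounded[OF matrix_vector_mul_bounded_linear[of "transpose E"]]
    by (auto simp: mult.commute)
  \<comment> \<open>The sum \<open>B + B * B\<close> majorizes the effect of one and of two
    applications of \<open>transpose E\<close> at once.\<close>
  define L where "L = (B + B * B) * \<bar>X\<bar> * (C * R)"
  have "L \<ge> 0" using B C R unfolding L_def by simp
  have L: "\<bar>y \<bullet> (T s *v \<eta>)\<bar> \<le> L * exp (\<mu> * s)"
    if "s \<ge> 0" "\<eta> \<in> shell" "norm y \<le> (B + B * B) * \<bar>X\<bar>" for s \<eta> y
  proof -
    have "\<bar>y \<bullet> (T s *v \<eta>)\<bar> \<le> norm y * norm (T s *v \<eta>)" by (rule Cauchy_Schwarz_ineq2)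
    also have "\<dots> \<le> ((B + B * B) * \<bar>X\<bar>) * (C * exp (\<mu> * s) * R)"
      using that(3) B C(1) R(1)
      by (intro mult_mono order_trans[OF C(2)[OF that(1)] mult_left_mono[OF R(2)[OF that(2)]]]) auto
    finally show ?thesis by (simp add: L_def algebra_simps)
  qed
  \<comment> \<open>The requirement is \<open>2 * L / t0 \<le> exp ((1 - \<mu>) * s)\<close>; the
    added 1 keeps the argument of the logarithm at least 1, hence \<open>s0\<close>
    nonnegative.\<close>
  define s0 where "s0 = ln (2 * L / t0 + 1) / (1 - \<mu>)"
  have "s0 \<ge> 0"
    unfolding s0_def using assms \<open>L \<ge> 0\<close> by simp
  show ?thesis
  proof (rule that[OF \<open>s0 \<ge> 0\<close>])
    fix s t :: real and x \<eta> :: "real^'n"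
    assume A: "s \<ge> s0" "t \<ge> t0" "norm x \<le> X" "\<eta> \<in> shell"
    have "s \<ge> 0" using A(1) \<open>s0 \<ge> 0\<close> by simp
    have "ln (2 * L / t0 + 1) \<le> (1 - \<mu>) * s"
      using A(1) assms unfolding s0_def by (simp add: field_simps)
    then have "2 * L / t0 + 1 \<le> exp ((1 - \<mu>) * s)"
      using assms \<open>L \<ge> 0\<close> by (metis add_nonneg_pos divide_nonneg_pos exp_le_cancel_iff exp_ln
          mult_nonneg_nonneg zero_le_numeral zero_less_one)
    then have "2 * L / t0 \<le> exp ((1 - \<mu>) * s)" by simp
    then have "L \<le> t0 / 2 * exp ((1 - \<mu>) * s)" using assms by (simp add: field_simps)
    then have "L * exp (\<mu> * s) \<le> t0 / 2 * exp ((1 - \<mu>) * s) * exp (\<mu> * s)" by simp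
    also have "\<dots> = t0 / 2 * exp s" by (simp add: algebra_simps flip: exp_add)
    also have "\<dots> \<le> t / 2 * exp s" using A(2) by simp
    finally have *: "L * exp (\<mu> * s) \<le> t / 2 * exp s" .
    have x: "norm x \<le> \<bar>X\<bar>" using A(3) by simp
    have n1: "norm (transpose E *v x) \<le> B * \<bar>X\<bar>"
      using B(1) by (intro order_trans[OF B(2)] mult_left_mono x) auto
    have n2: "norm (transpose E *v (transpose E *v x)) \<le> B * (B * \<bar>X\<bar>)"
      by (intro order_trans[OF B(2) mult_left_mono[OF n1]]) (use B(1) in simp)
    have "norm (transpose E *v x) \<le> (B + B * B) * \<bar>X\<bar>"
      "norm (transpose E *v (transpose E *v x)) \<le> (B + B * B) * \<bar>X\<bar>"
      using n1 n2 B(1) by (simp_all add: algebra_simps add_increasing add_increasing2)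
    with L[OF \<open>s \<ge> 0\<close> A(4)] *
    show "\<bar>(transpose E *v x) \<bullet> (T s *v \<eta>)\<bar> \<le> t / 2 * exp s \<and>
       \<bar>(transpose E *v (transpose E *v x)) \<bullet> (T s *v \<eta>)\<bar> \<le> t / 2 * exp s"
      by (meson order_trans)
  qed
qed

definition integrand :: "real \<Rightarrow> real^'n \<Rightarrow> real^'n \<Rightarrow> complex" where
  "integrand t x \<xi> = exp (- \<i> * complex_of_real (t * Q \<xi>) - \<i> * complex_of_real (x \<bullet> \<xi>))"

lemma norm_integrand [simp]: "norm (integrand t x \<xi>) = 1"
proof -
  have "integrand t x \<xi> = exp (\<i> * complex_of_real (- (t * Q \<xi>) - x \<bullet> \<xi>))"
    unfolding integrand_def by (simp add: algebra_simps)
  then show ?thesis by (simp only: norm_exp_i_times)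
qed

lemma measurable_integrand [measurable]: "integrand t x \<in> borel_measurable borel"
  unfolding integrand_def[abs_def] by measurable

lemma osc_int_eq: "osc_int Q \<tau> t x = (\<integral>\<xi>. indicat_real {\<xi>. \<bar>Q \<xi>\<bar> < \<tau>} \<xi> *\<^sub>R integrand t x \<xi> \<partial>lborel)"
  by (simp add: osc_int_def set_lebesgue_integral_def integrand_def)

lemma integrable_indicator_integrand:
  assumes [measurable]: "A \<in> sets borel" and "A \<subseteq> {\<xi>. \<bar>Q \<xi>\<bar> < \<tau>}"
  shows "integrable lborel (\<lambda>\<xi>. indicat_real A \<xi> *\<^sub>R integrand t x \<xi>)"
proof (rule Bochner_Integration.integrable_bound)
  show "integrable lborel (indicat_real {\<xi>. \<bar>Q \<xi>\<bar> < \<tau>})"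
    using emeasure_sublevel_finite by (intro integrable_real_indicator) auto
qed (use assms in \<open>auto simp: indicator_def\<close>)

lemma osc_int_diff:
  assumes "\<tau>1 \<le> \<tau>2"
  shows "osc_int Q \<tau>2 t x - osc_int Q \<tau>1 t x =
    (\<integral>\<xi>. indicat_real {\<xi>. \<tau>1 \<le> \<bar>Q \<xi>\<bar> \<and> \<bar>Q \<xi>\<bar> < \<tau>2} \<xi> *\<^sub>R integrand t x \<xi> \<partial>lborel)"
proof -
  have "osc_int Q \<tau>2 t x - osc_int Q \<tau>1 t x = (\<integral>\<xi>. indicat_real {\<xi>. \<bar>Q \<xi>\<bar> < \<tau>2} \<xi> *\<^sub>R integrand t x \<xi>
      - indicat_real {\<xi>. \<bar>Q \<xi>\<bar> < \<tau>1} \<xi> *\<^sub>R integrand t x \<xi> \<partial>lborel)"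
    unfolding osc_int_eq
    by (intro Bochner_Integration.integral_diff[symmetric] integrable_indicator_integrand[OF sublevel_sets order_refl])
  also have "\<dots> = (\<integral>\<xi>. indicat_real {\<xi>. \<tau>1 \<le> \<bar>Q \<xi>\<bar> \<and> \<bar>Q \<xi>\<bar> < \<tau>2} \<xi> *\<^sub>R integrand t x \<xi> \<partial>lborel)"
    using assms by (intro Bochner_Integration.integral_cong) (auto simp: indicator_def)
  finally show ?thesis .
qed

text \<open>Only the smaller level enters the bound, since the oscillatory estimate along an orbit
  is governed by its starting time; integrating over the shell costs no more than its finite
  volume.\<close>

lemma osc_int_Cauchy_bound:
  fixes X t0 :: real
  assumes "\<mu> < 1" "t0 > 0"
  obtains M \<tau>0 where "\<tau>0 > 0"
    "\<And>\<tau>1 \<tau>2 t x. \<tau>0 \<le> \<tau>1 \<Longrightarrow> \<tau>1 \<le> \<tau>2 \<Longrightarrow> t0 \<le> t \<Longrightarrow> norm x \<le> X \<Longrightarrow>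
       norm (osc_int Q \<tau>2 t x - osc_int Q \<tau>1 t x) \<le> M * \<tau>1 powr (\<mu> - 1)"
proof -
  obtain s0 where s0: "s0 \<ge> 0"
    "\<And>s t x \<eta>. s \<ge> s0 \<Longrightarrow> t \<ge> t0 \<Longrightarrow> norm x \<le> X \<Longrightarrow> \<eta> \<in> shell \<Longrightarrow>
       \<bar>(transpose E *v x) \<bullet> (T s *v \<eta>)\<bar> \<le> t / 2 * exp s \<and>
       \<bar>(transpose E *v (transpose E *v x)) \<bullet> (T s *v \<eta>)\<bar> \<le> t / 2 * exp s"
    using phase_bounds[OF assms] by blast
  \<comment> \<open>An orbit starting at \<open>\<eta>\<close> in the shell reaches the level
    \<open>\<tau>1\<close> at time \<open>ln \<tau>1 - ln \<bar>Q \<eta>\<bar>\<close>, above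
    \<open>ln \<tau>1 - 1\<close>. This unit of head start causes the factor
    \<open>exp (1 - \<mu>)\<close> and the threshold \<open>exp (s0 + 1)\<close>.\<close>
  define M where "M = 22 / ((1 - \<mu>) * t0) * exp (1 - \<mu>) * measure lborel shell"
  show ?thesis
  proof (rule that[of "exp (s0 + 1)" M])
    fix \<tau>1 \<tau>2 t and x :: "real^'n"
    assume \<tau>: "exp (s0 + 1) \<le> \<tau>1" "\<tau>1 \<le> \<tau>2" and t: "t0 \<le> t" and x: "norm x \<le> X"
    have pos: "\<tau>1 > 0" "\<tau>2 > 0" "t > 0"
      using \<tau> assms t less_le_trans[OF exp_gt_zero \<tau>(1)] by auto
    let ?A = "{\<xi>. \<tau>1 \<le> \<bar>Q \<xi>\<bar> \<and> \<bar>Q \<xi>\<bar> < \<tau>2}"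
    let ?f = "\<lambda>\<xi>. indicat_real ?A \<xi> *\<^sub>R integrand t x \<xi>"
    define B where "B = 22 / ((1 - \<mu>) * t0) * exp (1 - \<mu>) * \<tau>1 powr (\<mu> - 1)"
    have inner: "norm (\<integral>s. exp (s * \<mu>) *\<^sub>R ?f (T s *v \<eta>) \<partial>lborel) \<le> B" if \<eta>: "\<eta> \<in> shell" for \<eta>
    proof -
      define p where "p = \<bar>Q \<eta>\<bar>"
      have p: "1 \<le> p" "p < exp 1" using \<eta> by (auto simp: p_def)
      define a where "a = ln \<tau>1 - ln p"
      define b where "b = ln \<tau>2 - ln p"
      have "ln p < 1" using p by (metis exp_gt_zero less_le_trans ln_exp ln_less_cancel_iff zero_less_one)
      have "s0 + 1 \<le> ln \<tau>1" using \<tau>(1) pos by (simp add: ln_ge_iff)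
      then have a: "a \<ge> s0" "a \<ge> ln \<tau>1 - 1" using \<open>ln p < 1\<close> by (auto simp: a_def)
      have "a \<le> b" using \<tau>(2) pos by (simp add: a_def b_def)
      define \<psi> where "\<psi> s = x \<bullet> (T s *v \<eta>)" for s
      have "T s *v \<eta> \<in> ?A \<longleftrightarrow> s \<in> {a..<b}" for s
      proof -
        have "\<tau>1 \<le> exp s * p \<longleftrightarrow> a \<le> s"
          using pos(1) p(1) ln_ge_iff[of "exp s * p" "ln \<tau>1"] by (auto simp: a_def ln_mult)
        moreover have "\<tau>2 \<le> exp s * p \<longleftrightarrow> b \<le> s"
          using pos(2) p(1) ln_ge_iff[of "exp s * p" "ln \<tau>2"] by (auto simp: b_def ln_mult)
        ultimately show ?thesis
          by (auto simp: homogeneous abs_mult p_def not_le[symmetric])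
      qed
      then have ind: "indicat_real ?A (T s *v \<eta>) = indicator {a..<b} s" for s
        by (simp add: indicator_def)
      let ?h = "\<lambda>s. exp (s * \<mu>) *\<^sub>R exp (- \<i> * complex_of_real (t * (exp s * Q \<eta>) + \<psi> s))"
      have h: "exp (s * \<mu>) *\<^sub>R integrand t x (T s *v \<eta>) = ?h s" for s
      proof -
        have "- \<i> * complex_of_real (t * (exp s * Q \<eta>)) - \<i> * complex_of_real (\<psi> s) =
            - \<i> * complex_of_real (t * (exp s * Q \<eta>) + \<psi> s)"
          by (simp add: distrib_left)
        then show ?thesis unfolding integrand_def homogeneous \<psi>_def by (simp only:)
      qed
      have "(\<integral>s. exp (s * \<mu>) *\<^sub>R ?f (T s *v \<eta>) \<partial>lborel) = (\<integral>s. indicat_real {a..<b} s *\<^sub>R ?h s \<partial>lborel)"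
        unfolding ind h[symmetric] by (intro Bochner_Integration.integral_cong) simp_all
      also have "\<dots> = (\<integral>s. indicat_real {a..b} s *\<^sub>R ?h s \<partial>lborel)"
        by (intro integral_cong_AE)
          (use AE_lborel_singleton[of b] in \<open>auto simp: \<psi>_def indicator_def elim!: eventually_mono\<close>)
      also have "\<dots> = integral {a..b} ?h"
      proof -
        have "set_integrable lborel {a..b} ?h"
          unfolding \<psi>_def by (intro borel_integrable_atLeastAtMost' continuous_intros)
        from set_borel_integral_eq_integral(2)[OF this] show ?thesis
          by (simp add: set_lebesgue_integral_def)
      qed
      finally have eq: "(\<integral>s. exp (s * \<mu>) *\<^sub>R ?f (T s *v \<eta>) \<partial>lborel) = integral {a..b} ?h" .
      have "exp 1 \<le> (3 :: real)" by (rule exp_le)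
      have "norm (integral {a..b} ?h) \<le> 22 / ((1 - \<mu>) * t) * exp ((\<mu> - 1) * a)"
      proof (rule oscillatory_integral_bound)
        show "(\<psi> has_real_derivative (transpose E *v x) \<bullet> (T s *v \<eta>)) (at s)" for s
          unfolding \<psi>_def by (rule inner_mexp_has_derivative)
        show "((\<lambda>s. (transpose E *v x) \<bullet> (T s *v \<eta>)) has_real_derivative
            (transpose E *v (transpose E *v x)) \<bullet> (T s *v \<eta>)) (at s)" for s
          by (rule inner_mexp_has_derivative)
        show "1 \<le> \<bar>Q \<eta>\<bar>" "\<bar>Q \<eta>\<bar> \<le> 3" using p \<open>exp 1 \<le> 3\<close> unfolding p_def by auto
      qed (use s0(2)[OF _ t x \<eta>] a(1) pos(3) \<mu>_pos assms \<open>a \<le> b\<close> in auto)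
      also have "\<dots> \<le> 22 / ((1 - \<mu>) * t0) * (exp (1 - \<mu>) * \<tau>1 powr (\<mu> - 1))"
      proof (intro mult_mono)
        show "22 / ((1 - \<mu>) * t) \<le> 22 / ((1 - \<mu>) * t0)"
          using assms t pos by (intro divide_left_mono mult_left_mono) auto
        have "(\<mu> - 1) * a \<le> (\<mu> - 1) * (ln \<tau>1 - 1)"
          using a(2) assms by (intro mult_left_mono_neg) auto
        then have "exp ((\<mu> - 1) * a) \<le> exp ((1 - \<mu>) + (\<mu> - 1) * ln \<tau>1)" by (simp add: algebra_simps)
        then show "exp ((\<mu> - 1) * a) \<le> exp (1 - \<mu>) * \<tau>1 powr (\<mu> - 1)"
          using pos by (simp add: powr_def exp_add)
      qed (use assms in auto)
      finally show ?thesis unfolding eq B_def by (simp add: mult.assoc)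
    qed
    have "integrable lborel ?f"
      by (rule integrable_indicator_integrand[of _ \<tau>2]) auto
    then have "norm (osc_int Q \<tau>2 t x - osc_int Q \<tau>1 t x) =
        norm (\<integral>\<eta>. indicat_real shell \<eta> *\<^sub>R (\<integral>s. exp (s * \<mu>) *\<^sub>R ?f (T s *v \<eta>) \<partial>lborel) \<partial>lborel)"
      unfolding osc_int_diff[OF \<tau>(2)] by (subst polar_integral) simp_all
    also have "\<dots> \<le> (\<integral>\<eta>. norm (indicat_real shell \<eta> *\<^sub>R (\<integral>s. exp (s * \<mu>) *\<^sub>R ?f (T s *v \<eta>) \<partial>lborel)) \<partial>lborel)"
      by (rule integral_norm_bound)
    also have "\<dots> \<le> (\<integral>\<eta>. indicat_real shell \<eta> * B \<partial>lborel)"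
    proof (rule integral_mono')
      show "integrable lborel (\<lambda>\<eta>. indicat_real shell \<eta> * B)"
        using integrable_indicator_shell by (rule integrable_mult_left)
      have "B \<ge> 0" using assms unfolding B_def by simp
      then show "0 \<le> indicat_real shell \<eta> * B" for \<eta> by simp
      show "norm (indicat_real shell \<eta> *\<^sub>R (\<integral>s. exp (s * \<mu>) *\<^sub>R ?f (T s *v \<eta>) \<partial>lborel)) \<le> indicat_real shell \<eta> * B" for \<eta>
        using inner[of \<eta>] by (cases "\<eta> \<in> shell") (simp_all only: indicator_simps norm_scaleR, simp_all)
    qed
    also have "\<dots> = M * \<tau>1 powr (\<mu> - 1)"
      by (simp add: B_def M_def)
    finally show "norm (osc_int Q \<tau>2 t x - osc_int Q \<tau>1 t x) \<le> M * \<tau>1 powr (\<mu> - 1)" .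
  qed simp
qed

end

section \<open>Existence, uniformity and continuity of the limit, and its scaling\<close>

lemma tendsto_if_Cauchy_bound_at_top:
  fixes f :: "real \<Rightarrow> 'a :: banach"
  assumes f: "\<And>\<tau>1 \<tau>2. \<tau>0 \<le> \<tau>1 \<Longrightarrow> \<tau>1 \<le> \<tau>2 \<Longrightarrow> norm (f \<tau>2 - f \<tau>1) \<le> b \<tau>1"
    and b: "(b \<longlongrightarrow> 0) at_top"
  obtains l where "(f \<longlongrightarrow> l) at_top" "\<And>\<tau>. \<tau>0 \<le> \<tau> \<Longrightarrow> norm (l - f \<tau>) \<le> b \<tau>"
proof -
  have "Cauchy (\<lambda>n. f (real n))"
  proof (rule CauchyI')
    fix e :: real assume "e > 0"
    then have "eventually (\<lambda>\<tau>. b \<tau> < e) at_top"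
      using b order_tendstoD(2) by blast
    then obtain T where T: "\<And>\<tau>. \<tau> \<ge> T \<Longrightarrow> b \<tau> < e"
      by (auto simp: eventually_at_top_linorder)
    show "\<exists>M. \<forall>m\<ge>M. \<forall>n>m. dist (f (real m)) (f (real n)) < e"
    proof (intro exI allI impI)
      fix m n :: nat
      assume "nat \<lceil>max T \<tau>0\<rceil> \<le> m" "m < n"
      then have "T \<le> real m" "\<tau>0 \<le> real m" "real m \<le> real n" by linarith+
      with f[of "real m" "real n"] T[of "real m"] show "dist (f (real m)) (f (real n)) < e"
        by (simp add: dist_norm norm_minus_commute)
    qed
  qed
  then obtain l where l: "(\<lambda>n. f (real n)) \<longlonglongrightarrow> l"
    by (auto simp: Cauchy_convergent_iff convergent_def)
  \<comment> \<open>The larger argument goes to infinity along the integers while the bound stays at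
    the smaller one; the limit so inherits an explicit error.\<close>
  have le: "norm (l - f \<tau>) \<le> b \<tau>" if "\<tau>0 \<le> \<tau>" for \<tau>
  proof (rule tendsto_upperbound)
    show "(\<lambda>n. norm (f (real n) - f \<tau>)) \<longlonglongrightarrow> norm (l - f \<tau>)"
      by (intro tendsto_intros l)
    show "eventually (\<lambda>n. norm (f (real n) - f \<tau>) \<le> b \<tau>) sequentially"
      using eventually_ge_at_top[of "nat \<lceil>\<tau>\<rceil>"] by eventually_elim (use f[OF that] in \<open>simp add: nat_ceiling_le_eq\<close>)
  qed simp
  have "((\<lambda>\<tau>. f \<tau> - l) \<longlongrightarrow> 0) at_top"
    by (rule Lim_null_comparison[OF eventually_mono[OF eventually_ge_at_top[of \<tau>0]] b])
      (use le in \<open>simp add: norm_minus_commute\<close>)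
  then have "(f \<longlongrightarrow> l) at_top" by (simp add: LIM_zero_iff)
  with le show ?thesis by (intro that)
qed

lemma continuous_on_osc_int:
  assumes "continuous_on UNIV Q" "bounded {\<xi>. \<bar>Q \<xi>\<bar> < \<tau>}"
  shows "continuous_on UNIV (\<lambda>p. osc_int Q \<tau> (fst p) (snd p))"
proof -
  have [measurable]: "Q \<in> borel_measurable borel"
    using assms(1) by (rule borel_measurable_continuous_onI)
  have "(\<lambda>n. osc_int Q \<tau> (fst (p n)) (snd (p n))) \<longlonglongrightarrow> osc_int Q \<tau> (fst q) (snd q)"
    if p: "p \<longlonglongrightarrow> q" for p q
    unfolding osc_int_def set_lebesgue_integral_def
  proof (rule integral_dominated_convergence)
    show "integrable lborel (indicat_real {\<xi>. \<bar>Q \<xi>\<bar> < \<tau>})"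
      using emeasure_bounded_finite[OF assms(2)] by (intro integrable_real_indicator) auto
    show "AE \<xi> in lborel. (\<lambda>n. indicat_real {\<xi>. \<bar>Q \<xi>\<bar> < \<tau>} \<xi> *\<^sub>R
          exp (- \<i> * complex_of_real (fst (p n) * Q \<xi>) - \<i> * complex_of_real (snd (p n) \<bullet> \<xi>)))
        \<longlonglongrightarrow> indicat_real {\<xi>. \<bar>Q \<xi>\<bar> < \<tau>} \<xi> *\<^sub>R
          exp (- \<i> * complex_of_real (fst q * Q \<xi>) - \<i> * complex_of_real (snd q \<bullet> \<xi>))"
      by (intro AE_I2 tendsto_intros p)
    show "AE \<xi> in lborel. norm (indicat_real {\<xi>. \<bar>Q \<xi>\<bar> < \<tau>} \<xi> *\<^sub>R
          exp (- \<i> * complex_of_real (fst (p n) * Q \<xi>) - \<i> * complex_of_real (snd (p n) \<bullet> \<xi>)))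
        \<le> indicat_real {\<xi>. \<bar>Q \<xi>\<bar> < \<tau>} \<xi>" for n
      by (intro AE_I2) simp
  qed measurable
  then show ?thesis
    unfolding continuous_on_sequentially o_def by blast
qed

context homogeneous_function
begin

text \<open>\<open>H_iQ\<close> is defined through \<open>Lim\<close> and acquires its meaning only
  here, once a limit is known to exist. Since \<open>M\<close> and \<open>\<tau>0\<close> precede
  \<open>t\<close> and \<open>x\<close>, the same estimate yields uniformity.\<close>

lemma osc_int_limit:
  fixes X t0 :: real
  assumes "\<mu> < 1" "t0 > 0"
  obtains M \<tau>0 where
    "\<And>t x. t0 \<le> t \<Longrightarrow> norm x \<le> X \<Longrightarrow>
      ((\<lambda>\<tau>. osc_int Q \<tau> t x) \<longlongrightarrow> complex_of_real ((2 * pi) ^ CARD('n)) * H_iQ Q t x) at_top"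
    "\<And>\<tau> t x. t0 \<le> t \<Longrightarrow> norm x \<le> X \<Longrightarrow> \<tau>0 \<le> \<tau> \<Longrightarrow>
      norm (complex_of_real ((2 * pi) ^ CARD('n)) * H_iQ Q t x - osc_int Q \<tau> t x) \<le> M * \<tau> powr (\<mu> - 1)"
proof -
  obtain M \<tau>0 where M: "\<tau>0 > 0"
    "\<And>\<tau>1 \<tau>2 t x. \<tau>0 \<le> \<tau>1 \<Longrightarrow> \<tau>1 \<le> \<tau>2 \<Longrightarrow> t0 \<le> t \<Longrightarrow> norm x \<le> X \<Longrightarrow>
       norm (osc_int Q \<tau>2 t x - osc_int Q \<tau>1 t x) \<le> M * \<tau>1 powr (\<mu> - 1)"
    by (rule osc_int_Cauchy_bound[OF assms, of X]) (rule that)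
  have b: "((\<lambda>\<tau>. M * \<tau> powr (\<mu> - 1)) \<longlongrightarrow> 0) at_top"
    using tendsto_mult_right_zero[OF tendsto_neg_powr[OF _ filterlim_ident, of "\<mu> - 1"]] assms by simp
  have *: "((\<lambda>\<tau>. osc_int Q \<tau> t x) \<longlongrightarrow> complex_of_real ((2 * pi) ^ CARD('n)) * H_iQ Q t x) at_top \<and>
      (\<forall>\<tau>\<ge>\<tau>0. norm (complex_of_real ((2 * pi) ^ CARD('n)) * H_iQ Q t x - osc_int Q \<tau> t x) \<le> M * \<tau> powr (\<mu> - 1))"
    if tx: "t0 \<le> t" "norm x \<le> X" for t x
  proof -
    obtain l where l: "((\<lambda>\<tau>. osc_int Q \<tau> t x) \<longlongrightarrow> l) at_top"
      "\<And>\<tau>. \<tau>0 \<le> \<tau> \<Longrightarrow> norm (l - osc_int Q \<tau> t x) \<le> M * \<tau> powr (\<mu> - 1)"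
    proof (rule tendsto_if_Cauchy_bound_at_top[OF _ b])
      show "norm (osc_int Q \<tau>2 t x - osc_int Q \<tau>1 t x) \<le> M * \<tau>1 powr (\<mu> - 1)"
        if "\<tau>0 \<le> \<tau>1" "\<tau>1 \<le> \<tau>2" for \<tau>1 \<tau>2
        using M(2)[OF that tx] .
    qed (rule that)
    have "Lim at_top (\<lambda>\<tau>. osc_int Q \<tau> t x) = l"
      using l(1) by (intro tendsto_Lim) simp_all
    then have "complex_of_real ((2 * pi) ^ CARD('n)) * H_iQ Q t x = l"
      by (simp add: H_iQ_def)
    with l show ?thesis by metis
  qed
  show ?thesis
    by (rule that[of \<tau>0 M]) (rule conjunct1[OF *], assumption+, rule conjunct2[OF *, rule_format])
qed

lemma tendsto_osc_int:
  assumes "\<mu> < 1" "t > 0"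
  shows "((\<lambda>\<tau>. osc_int Q \<tau> t x) \<longlongrightarrow> complex_of_real ((2 * pi) ^ CARD('n)) * H_iQ Q t x) at_top"
  by (rule osc_int_limit[OF assms, of "norm x"]) (simp del: of_real_power)

lemma uniform_limit_osc_int:
  assumes "\<mu> < 1" "t0 > 0"
  shows "uniform_limit ({t0..} \<times> cball 0 X) (\<lambda>\<tau> p. osc_int Q \<tau> (fst p) (snd p))
    (\<lambda>p. complex_of_real ((2 * pi) ^ CARD('n)) * H_iQ Q (fst p) (snd p)) at_top"
proof (rule uniform_limitI)
  fix e :: real assume "e > 0"
  obtain M \<tau>0 where M: "\<And>\<tau> t x. t0 \<le> t \<Longrightarrow> norm x \<le> X \<Longrightarrow> \<tau>0 \<le> \<tau> \<Longrightarrow>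
      norm (complex_of_real ((2 * pi) ^ CARD('n)) * H_iQ Q t x - osc_int Q \<tau> t x) \<le> M * \<tau> powr (\<mu> - 1)"
    by (rule osc_int_limit[OF assms, of X]) (rule that)
  have "((\<lambda>\<tau>. M * \<tau> powr (\<mu> - 1)) \<longlongrightarrow> 0) at_top"
    using tendsto_mult_right_zero[OF tendsto_neg_powr[OF _ filterlim_ident, of "\<mu> - 1"]] assms by simp
  then have "eventually (\<lambda>\<tau>. M * \<tau> powr (\<mu> - 1) < e) at_top"
    using \<open>e > 0\<close> order_tendstoD(2) by blast
  then show "\<forall>\<^sub>F \<tau> in at_top. \<forall>p\<in>{t0..} \<times> cball 0 X.
      dist (osc_int Q \<tau> (fst p) (snd p)) (complex_of_real ((2 * pi) ^ CARD('n)) * H_iQ Q (fst p) (snd p)) < e"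
    using eventually_ge_at_top[of \<tau>0]
  proof eventually_elim
    case (elim \<tau>)
    then show ?case
      using M by (fastforce simp: dist_norm norm_minus_commute intro: le_less_trans)
  qed
qed

lemma continuous_on_H_iQ:
  assumes "\<mu> < 1"
  shows "continuous_on ({0<..} \<times> UNIV) (\<lambda>p. H_iQ Q (fst p) (snd p))"
proof -
  let ?c = "complex_of_real ((2 * pi) ^ CARD('n))"
  have "isCont (\<lambda>p. ?c * H_iQ Q (fst p) (snd p)) (t, x)" if "t > 0" for t x
  proof -
    \<comment> \<open>Convergence is uniform for times bounded away from 0 and points in a bounded
      set; an open neighbourhood of \<open>(t, x)\<close> of this kind is enough for continuity
      there.\<close>
    let ?U = "{t / 2<..} \<times> ball 0 (norm x + 1) :: (real \<times> (real^'n)) set"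
    have "uniform_limit ?U (\<lambda>\<tau> p. osc_int Q \<tau> (fst p) (snd p)) (\<lambda>p. ?c * H_iQ Q (fst p) (snd p)) at_top"
      by (rule uniform_limit_on_subset[OF uniform_limit_osc_int[OF assms, of "t / 2" "norm x + 1"]])
        (use that in auto)
    then have "continuous_on ?U (\<lambda>p. ?c * H_iQ Q (fst p) (snd p))"
      by (rule uniform_limit_theorem[rotated])
        (auto intro!: always_eventually continuous_on_subset[OF continuous_on_osc_int[OF cont bounded_sublevel]])
    moreover have "open ?U" "(t, x) \<in> ?U" using that by (auto intro: open_Times)
    ultimately show ?thesis
      using continuous_on_eq_continuous_at by blast
  qed
  then have "continuous_on ({0<..} \<times> UNIV) (\<lambda>p. ?c * H_iQ Q (fst p) (snd p))"
    by (intro continuous_at_imp_continuous_on) auto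
  then have "continuous_on ({0<..} \<times> UNIV) (\<lambda>p. inverse ?c * (?c * H_iQ Q (fst p) (snd p)))"
    by (rule continuous_on_mult[OF continuous_on_const])
  moreover have "inverse ?c * (?c * z) = z" for z
    by (subst mult.assoc[symmetric], subst left_inverse) simp_all
  ultimately show ?thesis by (simp only:)
qed

text \<open>Dividing \<open>Q\<close> by \<open>t\<close> removes the time from the phase and turns
  the cutoff into \<open>t * \<tau>\<close>. As this tends to infinity with \<open>\<tau>\<close>,
  the identity passes to the limit.\<close>

lemma osc_int_scaling:
  assumes "t > 0"
  shows "osc_int Q \<tau> t x = complex_of_real (t powr (- \<mu>)) * osc_int Q (t * \<tau>) 1 (transpose (T (- ln t)) *v x)"
proof -
  let ?f = "\<lambda>\<xi>. indicat_real {\<xi>. \<bar>Q \<xi>\<bar> < \<tau>} \<xi> *\<^sub>R integrand t x \<xi>"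
  have Qs: "Q (T (- ln t) *v \<eta>) = Q \<eta> / t" for \<eta>
    unfolding homogeneous using assms by (simp add: exp_minus field_simps)
  have "osc_int Q \<tau> t x = \<bar>det (T (- ln t))\<bar> *\<^sub>R (\<integral>\<eta>. ?f (T (- ln t) *v \<eta>) \<partial>lborel)"
    unfolding osc_int_eq by (rule integral_matrix_change_of_variables) (simp_all only: det_T, simp_all)
  also have "\<bar>det (T (- ln t))\<bar> = t powr (- \<mu>)"
    unfolding det_T using assms by (simp add: powr_def mult.commute)
  also have "(\<lambda>\<eta>. ?f (T (- ln t) *v \<eta>)) =
      (\<lambda>\<eta>. indicat_real {\<xi>. \<bar>Q \<xi>\<bar> < t * \<tau>} \<eta> *\<^sub>R integrand 1 (transpose (T (- ln t)) *v x) \<eta>)"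
  proof
    fix \<eta>
    have "\<bar>Q \<eta> / t\<bar> < \<tau> \<longleftrightarrow> \<bar>Q \<eta>\<bar> < t * \<tau>" using assms by (simp add: abs_divide field_simps)
    then have "indicat_real {\<xi>. \<bar>Q \<xi>\<bar> < \<tau>} (T (- ln t) *v \<eta>) = indicat_real {\<xi>. \<bar>Q \<xi>\<bar> < t * \<tau>} \<eta>"
      unfolding indicator_def mem_Collect_eq Qs by simp
    moreover have "integrand t x (T (- ln t) *v \<eta>) = integrand 1 (transpose (T (- ln t)) *v x) \<eta>"
      unfolding integrand_def Qs transpose_matrix_vector dot_lmul_matrix using assms by simp
    ultimately show "?f (T (- ln t) *v \<eta>) =
        indicat_real {\<xi>. \<bar>Q \<xi>\<bar> < t * \<tau>} \<eta> *\<^sub>R integrand 1 (transpose (T (- ln t)) *v x) \<eta>"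
      by (simp only:)
  qed
  finally show ?thesis
    unfolding osc_int_eq by (simp only: scaleR_conv_of_real)
qed

lemma H_iQ_scaling:
  assumes "\<mu> < 1" "t > 0"
  shows "H_iQ Q t x = complex_of_real (t powr (- \<mu>)) * H_iQ Q 1 (tpow t (- transpose E) *v x)"
proof -
  let ?c = "complex_of_real ((2 * pi) ^ CARD('n))"
  let ?y = "transpose (T (- ln t)) *v x"
  have "((\<lambda>\<tau>. osc_int Q (t * \<tau>) 1 ?y) \<longlongrightarrow> ?c * H_iQ Q 1 ?y) at_top"
    by (rule filterlim_compose[OF tendsto_osc_int[OF assms(1) zero_less_one]])
      (use assms(2) filterlim_tendsto_pos_mult_at_top[OF tendsto_const _ filterlim_ident, of t] in simp)
  then have "((\<lambda>\<tau>. osc_int Q \<tau> t x) \<longlongrightarrow> complex_of_real (t powr (- \<mu>)) * (?c * H_iQ Q 1 ?y)) at_top"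
    unfolding osc_int_scaling[OF assms(2)] by (intro tendsto_intros)
  from tendsto_unique[OF _ tendsto_osc_int[OF assms] this]
  have "?c * H_iQ Q t x = ?c * (complex_of_real (t powr (- \<mu>)) * H_iQ Q 1 ?y)"
    by (simp add: mult.left_commute)
  then have "H_iQ Q t x = complex_of_real (t powr (- \<mu>)) * H_iQ Q 1 ?y" by simp
  moreover have "tpow t (- transpose E) = transpose (T (- ln t))"
  proof -
    have "ln t *\<^sub>R (- transpose E) = transpose ((- ln t) *\<^sub>R E)"
      by (simp add: vec_eq_iff transpose_def)
    then show ?thesis by (simp only: tpow_def mexp_transpose)
  qed
  ultimately show ?thesis by simp
qed

end

section \<open>The Mellin transform of the cosine\<close>

text \<open>The substitution is performed on the compact intervals
  \<open>{- real n..real n}\<close>, and monotone convergence removes the truncation on both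
  sides.\<close>

lemma nn_integral_exp_substitution:
  fixes f :: "real \<Rightarrow> real"
  assumes [measurable]: "f \<in> borel_measurable borel"
  shows "(\<integral>\<^sup>+r. ennreal (f r) * indicator {0<..} r \<partial>lborel) = (\<integral>\<^sup>+s. ennreal (f (exp s) * exp s) \<partial>lborel)"
proof -
  let ?A = "\<lambda>n::nat. {exp (- real n)..exp (real n)}"
  have inc: "incseq ?A" "incseq (\<lambda>n::nat. {- real n..real n})"
    by (auto simp: incseq_def intro: order_trans)
  have UN1: "(\<Union>n. ?A n) = {0<..}"
  proof (intro equalityI subsetI)
    fix r :: real assume "r \<in> {0<..}"
    moreover obtain n :: nat where "\<bar>ln r\<bar> \<le> real n"
      using real_arch_simple by blast
    ultimately have "exp (- real n) \<le> exp (ln r)" "exp (ln r) \<le> exp (real n)" "r > 0"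
      by (simp_all only: exp_le_cancel_iff) auto
    then show "r \<in> (\<Union>n. ?A n)" by auto
  qed (auto intro: less_le_trans[OF exp_gt_zero])
  have UN2: "(\<Union>n. {- real n..real n}) = (UNIV :: real set)"
  proof -
    have "\<exists>n. s \<in> {- real n..real n}" for s
      using real_arch_simple[of "\<bar>s\<bar>"] by (auto simp: abs_le_iff minus_le_iff)
    then show ?thesis by blast
  qed
  have lim: "(\<integral>\<^sup>+x. g x * indicator (\<Union>n. B n) x \<partial>lborel) = (SUP n. \<integral>\<^sup>+x. g x * indicator (B n) x \<partial>lborel)"
    if "incseq B" and [measurable]: "\<And>n. B n \<in> sets borel" "g \<in> borel_measurable borel"
    for B :: "nat \<Rightarrow> real set" and g :: "real \<Rightarrow> ennreal"
  proof -
    have "(SUP n. \<integral>\<^sup>+x. g x * indicator (B n) x \<partial>lborel) = (SUP n. emeasure (density lborel g) (B n))"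
      by (simp add: emeasure_density)
    also have "\<dots> = emeasure (density lborel g) (\<Union>n. B n)"
      by (rule SUP_emeasure_incseq) (use that in auto)
    finally show ?thesis by (simp add: emeasure_density)
  qed
  have "(\<integral>\<^sup>+r. ennreal (f r) * indicator (?A n) r \<partial>lborel) =
      (\<integral>\<^sup>+s. ennreal (f (exp s) * exp s) * indicator {- real n..real n} s \<partial>lborel)" for n
  proof -
    have "(\<integral>\<^sup>+r. ennreal (f r * indicator {exp (- real n)..exp (real n)} r) \<partial>lborel) =
      (\<integral>\<^sup>+s. ennreal (f (exp s) * exp s * indicator {- real n..real n} s) \<partial>lborel)"
      by (rule nn_integral_substitution)
        (auto simp: set_borel_measurable_def intro!: derivative_eq_intros continuous_intros)
    then show ?thesis by (simp only: ennreal_mult''[OF indicator_pos_le] ennreal_indicator)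
  qed
  then show ?thesis
    using lim[OF inc(1), of "\<lambda>r. ennreal (f r)"] lim[OF inc(2), of "\<lambda>s. ennreal (f (exp s) * exp s)"]
    by (simp add: UN1 UN2)
qed

lemma nn_integral_powr_exp:
  fixes a c :: real
  assumes "a > 0" "c > 0"
  shows "(\<integral>\<^sup>+u. ennreal (u powr (a - 1) * exp (- c * u)) * indicator {0<..} u \<partial>lborel) = ennreal (Gamma a * c powr (- a))"
proof -
  have "(\<integral>\<^sup>+u. ennreal (u powr (a - 1) * exp (- u)) * indicator {0<..} u \<partial>lborel) = ennreal (Gamma a)"
    unfolding Gamma_conv_nn_integral_real[OF assms(1)]
    by (intro nn_integral_cong) (auto simp: indicator_def exp_minus field_simps)
  also have "(\<integral>\<^sup>+u. ennreal (u powr (a - 1) * exp (- u)) * indicator {0<..} u \<partial>lborel) =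
      ennreal \<bar>c\<bar> * (\<integral>\<^sup>+u. ennreal ((0 + c * u) powr (a - 1) * exp (- (0 + c * u))) * indicator {0<..} (0 + c * u) \<partial>lborel)"
    using assms(2) by (intro nn_integral_real_affine) auto
  also have "\<dots> = ennreal (c powr a) * (\<integral>\<^sup>+u. ennreal (u powr (a - 1) * exp (- c * u)) * indicator {0<..} u \<partial>lborel)"
  proof -
    have "ennreal \<bar>c\<bar> * (ennreal ((0 + c * u) powr (a - 1) * exp (- (0 + c * u))) * indicator {0<..} (0 + c * u)) =
        ennreal (c powr a) * (ennreal (u powr (a - 1) * exp (- c * u)) * indicator {0<..} u)" for u
    proof (cases "u > 0")
      case True
      have "c * (c * u) powr (a - 1) = c powr a * u powr (a - 1)"
        using True assms(2) by (simp add: powr_mult powr_diff)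
      then show ?thesis
        using True assms(2) by (simp add: ennreal_mult[symmetric] mult.assoc[symmetric])
    qed (use assms(2) in \<open>auto simp: indicator_def zero_less_mult_iff\<close>)
    then show ?thesis by (simp add: nn_integral_cmult[symmetric])
  qed
  finally have "ennreal (c powr - a) * ennreal (Gamma a) =
      ennreal (c powr - a) * ennreal (c powr a) * (\<integral>\<^sup>+u. ennreal (u powr (a - 1) * exp (- c * u)) * indicator {0<..} u \<partial>lborel)"
    by (simp add: mult.assoc)
  moreover have "ennreal (c powr - a) * ennreal (c powr a) = 1"
    using assms(2) by (simp add: ennreal_mult[symmetric] powr_add[symmetric])
  ultimately show ?thesis
    using assms by (simp add: ennreal_mult[symmetric] mult.commute Gamma_real_pos less_imp_le)
qed

lemma Gamma_reflection_real:
  fixes x :: real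
  shows "Gamma x * Gamma (1 - x) = pi / sin (pi * x)"
proof -
  have "complex_of_real (Gamma x * Gamma (1 - x)) = complex_of_real (pi / sin (pi * x))"
  proof -
    have "1 - complex_of_real x = complex_of_real (1 - x)"
      "sin (complex_of_real pi * complex_of_real x) = complex_of_real (sin (pi * x))"
      by (simp_all flip: sin_of_real)
    with Gamma_reflection_complex[of "complex_of_real x"] show ?thesis
      by (simp only: Gamma_complex_of_real of_real_mult of_real_divide)
  qed
  then show ?thesis by (simp only: of_real_eq_iff)
qed

text \<open>Writing \<open>1 / (1 + v)\<close> as the integral of \<open>exp (- (1 + v) * w)\<close>
  over positive \<open>w\<close> and exchanging by Tonelli produces
  \<open>Gamma (1 - a) * Gamma a\<close>, which the reflection formula evaluates.\<close>

lemma nn_integral_powr_div_add_one: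
  fixes a :: real
  assumes "0 < a" "a < 1"
  shows "(\<integral>\<^sup>+v. ennreal (v powr (- a) / (1 + v)) * indicator {0<..} v \<partial>lborel) = ennreal (pi / sin (pi * a))"
proof -
  have "(\<integral>\<^sup>+v. ennreal (v powr (- a) / (1 + v)) * indicator {0<..} v \<partial>lborel) =
      (\<integral>\<^sup>+v. (\<integral>\<^sup>+w. ennreal (v powr (- a) * exp (- v * w) * exp (- w)) * indicator {0<..} v * indicator {0<..} w \<partial>lborel) \<partial>lborel)"
  proof (intro nn_integral_cong)
    fix v :: real
    show "ennreal (v powr (- a) / (1 + v)) * indicator {0<..} v =
        (\<integral>\<^sup>+w. ennreal (v powr (- a) * exp (- v * w) * exp (- w)) * indicator {0<..} v * indicator {0<..} w \<partial>lborel)"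
    proof (cases "v > 0")
      case True
      have "(\<integral>\<^sup>+w. ennreal (v powr (- a) * exp (- v * w) * exp (- w)) * indicator {0<..} v * indicator {0<..} w \<partial>lborel) =
          (\<integral>\<^sup>+w. ennreal (v powr (- a)) * (ennreal (w powr (1 - 1) * exp (- (1 + v) * w)) * indicator {0<..} w) \<partial>lborel)"
        using True
        by (intro nn_integral_cong) (auto simp: indicator_def ennreal_mult[symmetric] exp_add[symmetric] algebra_simps)
      also have "\<dots> = ennreal (v powr (- a)) * ennreal (Gamma 1 * (1 + v) powr (- 1))"
        using True by (subst nn_integral_cmult) (simp_all add: nn_integral_powr_exp[of 1 "1 + v", simplified])
      also have "\<dots> = ennreal (v powr (- a) / (1 + v))"
        using True by (simp add: ennreal_mult[symmetric] powr_minus divide_inverse)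
      finally show ?thesis using True by simp
    qed simp
  qed
  also have "\<dots> = (\<integral>\<^sup>+w. (\<integral>\<^sup>+v. ennreal (v powr (- a) * exp (- v * w) * exp (- w)) * indicator {0<..} v * indicator {0<..} w \<partial>lborel) \<partial>lborel)"
    by (rule lborel_pair.Fubini') measurable
  also have "\<dots> = (\<integral>\<^sup>+w. ennreal (Gamma (1 - a)) * (ennreal (w powr (a - 1) * exp (- 1 * w)) * indicator {0<..} w) \<partial>lborel)"
  proof (intro nn_integral_cong)
    fix w :: real
    show "(\<integral>\<^sup>+v. ennreal (v powr (- a) * exp (- v * w) * exp (- w)) * indicator {0<..} v * indicator {0<..} w \<partial>lborel) =
        ennreal (Gamma (1 - a)) * (ennreal (w powr (a - 1) * exp (- 1 * w)) * indicator {0<..} w)"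
    proof (cases "w > 0")
      case True
      have "(\<integral>\<^sup>+v. ennreal (v powr (- a) * exp (- v * w) * exp (- w)) * indicator {0<..} v * indicator {0<..} w \<partial>lborel) =
          (\<integral>\<^sup>+v. ennreal (exp (- w)) * (ennreal (v powr ((1 - a) - 1) * exp (- w * v)) * indicator {0<..} v) \<partial>lborel)"
        using True
        by (intro nn_integral_cong) (auto simp: indicator_def ennreal_mult[symmetric] mult.commute)
      also have "\<dots> = ennreal (exp (- w)) * ennreal (Gamma (1 - a) * w powr (- (1 - a)))"
        using True assms by (subst nn_integral_cmult) (simp_all only: nn_integral_powr_exp[of "1 - a" w], simp_all)
      finally show ?thesis
        using True assms by (simp add: ennreal_mult[symmetric] mult_ac Gamma_real_pos less_imp_le)
    qed simp
  qed
  also have "\<dots> = ennreal (Gamma (1 - a)) * ennreal (Gamma a)"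
    using assms by (subst nn_integral_cmult) (simp_all only: nn_integral_powr_exp[of a 1], simp_all)
  also have "\<dots> = ennreal (pi / sin (pi * a))"
    using assms by (simp add: ennreal_mult[symmetric] Gamma_real_pos less_imp_le Gamma_reflection_real[symmetric] mult.commute)
  finally show ?thesis .
qed

text \<open>The substitution \<open>v = u\<^sup>2\<close> becomes halving of the logarithmic
  variable and leads to the preceding integral with exponent \<open>\<mu> / 2\<close>.\<close>

lemma nn_integral_powr_div_add_one_square:
  fixes \<mu> :: real
  assumes "0 < \<mu>" "\<mu> < 1"
  shows "(\<integral>\<^sup>+u. ennreal (u powr (- \<mu>) * (u / (1 + u\<^sup>2))) * indicator {0<..} u \<partial>lborel) =
    ennreal (pi / (2 * sin (pi * \<mu> / 2)))"
proof -
  let ?g = "\<lambda>s::real. exp s powr (- \<mu>) * (exp s / (1 + (exp s)\<^sup>2)) * exp s"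
  have "(\<integral>\<^sup>+u. ennreal (u powr (- \<mu>) * (u / (1 + u\<^sup>2))) * indicator {0<..} u \<partial>lborel) =
      (\<integral>\<^sup>+s. ennreal (?g s) \<partial>lborel)"
    by (rule nn_integral_exp_substitution) measurable
  also have "\<dots> = ennreal \<bar>1 / 2\<bar> * (\<integral>\<^sup>+s. ennreal (?g (0 + 1 / 2 * s)) \<partial>lborel)"
    by (rule nn_integral_real_affine) auto
  also have "(\<lambda>s. ?g (0 + 1 / 2 * s)) = (\<lambda>s. exp s powr (- (\<mu> / 2)) / (1 + exp s) * exp s)"
  proof
    fix s :: real
    have "(exp (1 / 2 * s))\<^sup>2 = exp s" "exp (1 / 2 * s) * exp (1 / 2 * s) = exp s"
      by (simp_all add: exp_double[symmetric] flip: exp_add)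
    moreover have "exp (1 / 2 * s) powr (- \<mu>) = exp s powr (- (\<mu> / 2))"
      by (simp add: powr_def)
    ultimately show "?g (0 + 1 / 2 * s) = exp s powr (- (\<mu> / 2)) / (1 + exp s) * exp s"
      by simp
  qed
  also have "(\<integral>\<^sup>+s. ennreal (exp s powr (- (\<mu> / 2)) / (1 + exp s) * exp s) \<partial>lborel) =
      (\<integral>\<^sup>+v. ennreal (v powr (- (\<mu> / 2)) / (1 + v)) * indicator {0<..} v \<partial>lborel)"
    by (rule nn_integral_exp_substitution[symmetric]) measurable
  also have "\<dots> = ennreal (pi / sin (pi * (\<mu> / 2)))"
    using assms by (intro nn_integral_powr_div_add_one) auto
  also have "ennreal \<bar>1 / 2\<bar> * ennreal (pi / sin (pi * (\<mu> / 2))) = ennreal (pi / (2 * sin (pi * \<mu> / 2)))"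
    by (subst ennreal_mult'[symmetric]) (simp_all only: abs_ge_zero, simp)
  finally show ?thesis .
qed

lemma has_bochner_integral_powr_exp:
  fixes a c :: real
  assumes "a > 0" "c > 0"
  shows "has_bochner_integral lborel (\<lambda>u. indicator {0<..} u * (u powr (a - 1) * exp (- c * u))) (Gamma a * c powr (- a))"
proof (rule has_bochner_integral_nn_integral)
  show "(\<integral>\<^sup>+u. ennreal (indicator {0<..} u * (u powr (a - 1) * exp (- c * u))) \<partial>lborel) = ennreal (Gamma a * c powr (- a))"
    unfolding nn_integral_powr_exp[OF assms, symmetric]
    by (intro nn_integral_cong) (auto simp: indicator_def)
qed (use assms in \<open>auto simp: Gamma_real_pos less_imp_le\<close>)

lemma integral_exp_mult_cos:
  fixes u \<tau> :: real
  assumes "\<tau> > 0"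
  shows "(\<integral>r. indicator {0<..<\<tau>} r * (exp (- r * u) * cos r) \<partial>lborel) =
    u / (1 + u\<^sup>2) + exp (- \<tau> * u) * (sin \<tau> - u * cos \<tau>) / (1 + u\<^sup>2)"
proof -
  have nz: "1 + u\<^sup>2 \<noteq> 0" using zero_le_power2[of u] by linarith
  \<comment> \<open>An antiderivative of \<open>exp (- r * u) * cos r\<close>; \<open>- F 0\<close>
    is the term \<open>u / (1 + u\<^sup>2)\<close> that remains as \<open>\<tau>\<close>
    grows.\<close>
  define F where "F r = exp (- r * u) * (sin r - u * cos r) / (1 + u\<^sup>2)" for r
  have "(\<integral>r. indicator {0<..<\<tau>} r * (exp (- r * u) * cos r) \<partial>lborel) =
      (\<integral>r. indicator {0..\<tau>} r *\<^sub>R (exp (- r * u) * cos r) \<partial>lborel)"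
    by (intro integral_cong_AE)
      (use AE_lborel_singleton[of 0] AE_lborel_singleton[of \<tau>] in \<open>auto simp: indicator_def\<close>)
  also have "\<dots> = F \<tau> - F 0"
  proof (rule integral_FTC_atLeastAtMost)
    fix r
    have "(F has_real_derivative exp (- r * u) * cos r) (at r)"
    proof -
      have "(F has_real_derivative ((exp (- r * u) * (cos r + u * sin r) + (- u * exp (- r * u)) * (sin r - u * cos r)) / (1 + u\<^sup>2))) (at r)"
        unfolding F_def[abs_def] by (rule DERIV_cdivide) (auto intro!: derivative_eq_intros simp: algebra_simps)
      moreover have "exp (- r * u) * (cos r + u * sin r) + (- u * exp (- r * u)) * (sin r - u * cos r) =
          exp (- r * u) * cos r * (1 + u\<^sup>2)"
        by (simp add: algebra_simps power2_eq_square)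
      ultimately show ?thesis using nz by simp
    qed
    then show "(F has_vector_derivative exp (- r * u) * cos r) (at r within {0..\<tau>})"
      by (simp add: has_real_derivative_iff_has_vector_derivative has_vector_derivative_at_within)
  qed (use assms in \<open>auto intro!: continuous_intros\<close>)
  finally show ?thesis by (simp add: F_def)
qed

text \<open>Writing \<open>r powr (\<mu> - 1)\<close> as a Laplace transform of
  \<open>u powr (- \<mu>)\<close> and exchanging the integrals turns the conditionally convergent integral into an
  absolutely convergent one.\<close>

lemma tendsto_integral_powr_mult_cos:
  fixes \<mu> :: real
  assumes \<mu>: "0 < \<mu>" "\<mu> < 1"
  shows "((\<lambda>\<tau>. \<integral>r. indicator {0<..<\<tau>} r * (r powr (\<mu> - 1) * cos r) \<partial>lborel) \<longlongrightarrow>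
    Gamma \<mu> * cos (\<mu> * pi / 2)) at_top"
proof -
  define J where "J \<tau> u = u / (1 + u\<^sup>2) + exp (- \<tau> * u) * (sin \<tau> - u * cos \<tau>) / (1 + u\<^sup>2)" for \<tau> u :: real
  let ?I = "\<lambda>\<tau>. \<integral>r. indicator {0<..<\<tau>} r * (r powr (\<mu> - 1) * cos r) \<partial>lborel"
  have Gpos: "Gamma (1 - \<mu>) > 0" using \<mu> by (intro Gamma_real_pos) simp
  have swap: "Gamma (1 - \<mu>) * ?I \<tau> = (\<integral>u. indicator {0<..} u * (u powr (- \<mu>) * J \<tau> u) \<partial>lborel)" if "\<tau> > 0" for \<tau>
  proof -
    \<comment> \<open>Integrating \<open>k\<close> in \<open>u\<close> gives
      \<open>Gamma (1 - \<mu>) * r powr (\<mu> - 1) * cos r\<close>, integrating it in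
      \<open>r\<close> gives \<open>u powr (- \<mu>) * J \<tau> u\<close>.\<close>
    define k where "k r u = indicator {0<..<\<tau>} r * cos r * (indicator {0<..} u * (u powr ((1 - \<mu>) - 1) * exp (- r * u)))" for r u :: real
    have [measurable]: "case_prod k \<in> borel_measurable (lborel \<Otimes>\<^sub>M lborel)"
      unfolding k_def by measurable
    have hb: "has_bochner_integral lborel (k r) (Gamma (1 - \<mu>) * (indicator {0<..<\<tau>} r * (r powr (\<mu> - 1) * cos r)))" for r
    proof (cases "r \<in> {0<..<\<tau>}")
      case True
      then have "has_bochner_integral lborel (k r) (indicator {0<..<\<tau>} r * cos r * (Gamma (1 - \<mu>) * r powr (- (1 - \<mu>))))"
        unfolding k_def using \<mu> by (intro has_bochner_integral_mult_right has_bochner_integral_powr_exp) auto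
      moreover have "indicator {0<..<\<tau>} r * cos r * (Gamma (1 - \<mu>) * r powr (- (1 - \<mu>))) =
          Gamma (1 - \<mu>) * (indicator {0<..<\<tau>} r * (r powr (\<mu> - 1) * cos r))"
        by simp
      ultimately show ?thesis by (simp only:)
    next
      case False
      then show ?thesis unfolding k_def by (simp add: has_bochner_integral_zero)
    qed
    have hb_norm: "(\<integral>u. \<bar>k r u\<bar> \<partial>lborel) = Gamma (1 - \<mu>) * (indicator {0<..<\<tau>} r * (r powr (\<mu> - 1) * \<bar>cos r\<bar>))" for r
    proof (cases "r \<in> {0<..<\<tau>}")
      case True
      have "(\<integral>u. \<bar>k r u\<bar> \<partial>lborel) =
          (\<integral>u. \<bar>cos r\<bar> * (indicator {0<..} u * (u powr ((1 - \<mu>) - 1) * exp (- r * u))) \<partial>lborel)"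
        using True by (intro Bochner_Integration.integral_cong) (auto simp: k_def abs_mult)
      also have "\<dots> = \<bar>cos r\<bar> * (Gamma (1 - \<mu>) * r powr (- (1 - \<mu>)))"
        using True \<mu>
        by (intro has_bochner_integral_integral_eq has_bochner_integral_mult_right has_bochner_integral_powr_exp) auto
      finally show ?thesis using True by (simp add: mult_ac)
    qed (simp add: k_def)
    have "integrable (lborel \<Otimes>\<^sub>M lborel) (case_prod k)"
    proof (rule lborel_pair.Fubini_integrable)
      \<comment> \<open>On \<open>{0<..<\<tau>}\<close> one has
        \<open>\<bar>cos r\<bar> \<le> exp (\<tau> - r)\<close>, so the Gamma integrand times
        \<open>exp \<tau>\<close> is a majorant.\<close>
      have "integrable lborel (\<lambda>r. exp \<tau> * Gamma (1 - \<mu>) * (indicator {0<..} r * (r powr (\<mu> - 1) * exp (- 1 * r))))"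
        using has_bochner_integral_powr_exp[of \<mu> 1] \<mu> by (intro integrable_mult_right) (auto simp: has_bochner_integral_iff)
      then show "integrable lborel (\<lambda>r. \<integral>u. norm (case_prod k (r, u)) \<partial>lborel)"
      proof (rule Bochner_Integration.integrable_bound)
        show "AE r in lborel. norm (\<integral>u. norm (case_prod k (r, u)) \<partial>lborel) \<le>
            norm (exp \<tau> * Gamma (1 - \<mu>) * (indicator {0<..} r * (r powr (\<mu> - 1) * exp (- 1 * r))))"
        proof (rule AE_I2)
          fix r :: real
          show "norm (\<integral>u. norm (case_prod k (r, u)) \<partial>lborel) \<le>
            norm (exp \<tau> * Gamma (1 - \<mu>) * (indicator {0<..} r * (r powr (\<mu> - 1) * exp (- 1 * r))))"
          proof (cases "r \<in> {0<..<\<tau>}")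
            case True
            have "\<bar>cos r\<bar> \<le> exp \<tau> * exp (- 1 * r)"
              using True order_trans[OF abs_cos_le_one[of r], of "exp (\<tau> - r)"] by (simp flip: exp_add)
            then have "Gamma (1 - \<mu>) * r powr (\<mu> - 1) * \<bar>cos r\<bar> \<le> Gamma (1 - \<mu>) * r powr (\<mu> - 1) * (exp \<tau> * exp (- 1 * r))"
              using Gpos by (intro mult_left_mono) auto
            then show ?thesis using True Gpos by (simp add: hb_norm abs_mult mult_ac)
          qed (simp add: hb_norm)
        qed
      qed measurable
      show "AE r in lborel. integrable lborel (\<lambda>u. case_prod k (r, u))"
        using hb by (auto simp: has_bochner_integral_iff)
    qed simp
    from lborel_pair.Fubini_integral[OF this]
    have fubini: "(\<integral>r. (\<integral>u. k r u \<partial>lborel) \<partial>lborel) = (\<integral>u. (\<integral>r. k r u \<partial>lborel) \<partial>lborel)" ..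
    have "(\<integral>r. k r u \<partial>lborel) = indicator {0<..} u * (u powr (- \<mu>) * J \<tau> u)" for u
    proof -
      have "(\<integral>r. k r u \<partial>lborel) = (\<integral>r. indicator {0<..} u * u powr (- \<mu>) * (indicator {0<..<\<tau>} r * (exp (- r * u) * cos r)) \<partial>lborel)"
        by (intro Bochner_Integration.integral_cong) (simp_all add: k_def mult_ac)
      also have "\<dots> = indicator {0<..} u * u powr (- \<mu>) * J \<tau> u"
        unfolding integral_mult_right_zero integral_exp_mult_cos[OF that] J_def ..
      finally show ?thesis by (simp only: mult.assoc)
    qed
    with fubini show ?thesis
      by (simp only: has_bochner_integral_integral_eq[OF hb] integral_mult_right_zero)
  qed
  define g where "g u = indicator {0<..} u * (u powr (- \<mu>) * (u / (1 + u\<^sup>2)))" for u :: real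
  have [measurable]: "g \<in> borel_measurable borel" unfolding g_def[abs_def] by measurable
  have hb_g: "has_bochner_integral lborel g (pi / (2 * sin (pi * \<mu> / 2)))"
  proof (rule has_bochner_integral_nn_integral)
    show "(\<integral>\<^sup>+u. ennreal (g u) \<partial>lborel) = ennreal (pi / (2 * sin (pi * \<mu> / 2)))"
      unfolding nn_integral_powr_div_add_one_square[OF \<mu>, symmetric] g_def
      by (intro nn_integral_cong) (auto simp: indicator_def)
    have "sin (pi * \<mu> / 2) > 0"
      using \<mu> by (intro sin_gt_zero) auto
    then show "0 \<le> pi / (2 * sin (pi * \<mu> / 2))" by simp
  qed (auto simp: g_def indicator_def)
  have "((\<lambda>\<tau>. \<integral>u. indicator {0<..} u * (u powr (- \<mu>) * J \<tau> u) \<partial>lborel) \<longlongrightarrow> (\<integral>u. g u \<partial>lborel)) at_top"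
  proof (rule integral_dominated_convergence_at_top)
    \<comment> \<open>For \<open>\<tau> \<ge> 1\<close> the part of \<open>J\<close> independent of
      \<open>\<tau>\<close> contributes \<open>g\<close>, and the other part is at most
      \<open>2 * exp (- u)\<close>, because \<open>1 + u \<le> 2 * (1 + u\<^sup>2)\<close>.\<close>
    let ?w = "\<lambda>u. g u + 2 * (indicator {0<..} u * (u powr ((1 - \<mu>) - 1) * exp (- 1 * u)))"
    show "integrable lborel ?w"
      using hb_g has_bochner_integral_powr_exp[of "1 - \<mu>" 1] \<mu>
      by (intro Bochner_Integration.integrable_add integrable_mult_right) (auto simp: has_bochner_integral_iff)
    have frac: "\<bar>(sin \<tau> - u * cos \<tau>) / (1 + u\<^sup>2)\<bar> \<le> 2" if "u > 0" for u \<tau> :: real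
    proof -
      have "\<bar>u * cos \<tau>\<bar> \<le> u * 1" unfolding abs_mult using that by (intro mult_mono) auto
      then have "\<bar>sin \<tau> - u * cos \<tau>\<bar> \<le> 1 + u" using abs_sin_le_one[of \<tau>] by linarith
      also have "\<dots> \<le> 2 * (1 + u\<^sup>2)"
      proof -
        have "2 * u \<le> 1 + u\<^sup>2" using sum_squares_bound[of u 1] by simp
        with that zero_le_power2[of u] show ?thesis unfolding distrib_left by linarith
      qed
      finally show ?thesis by (simp add: abs_divide divide_le_eq add_pos_nonneg)
    qed
    have split: "J \<tau> u = u / (1 + u\<^sup>2) + exp (- \<tau> * u) * ((sin \<tau> - u * cos \<tau>) / (1 + u\<^sup>2))" for \<tau> u
      by (simp add: J_def)
    have small: "\<bar>exp (- \<tau> * u) * ((sin \<tau> - u * cos \<tau>) / (1 + u\<^sup>2))\<bar> \<le> exp (- \<tau> * u) * 2" if "u > 0" for u \<tau> :: real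
      unfolding abs_mult using frac[OF that] by (intro mult_mono) auto
    show "AE u in lborel. ((\<lambda>\<tau>. indicator {0<..} u * (u powr (- \<mu>) * J \<tau> u)) \<longlongrightarrow> g u) at_top"
    proof (rule AE_I2)
      fix u :: real
      show "((\<lambda>\<tau>. indicator {0<..} u * (u powr (- \<mu>) * J \<tau> u)) \<longlongrightarrow> g u) at_top"
      proof (cases "u > 0")
        case True
        have "filterlim (\<lambda>\<tau>. u * \<tau>) at_top at_top"
          by (rule filterlim_tendsto_pos_mult_at_top[OF tendsto_const True filterlim_ident])
        then have "((\<lambda>\<tau>. exp (- \<tau> * u)) \<longlongrightarrow> 0) at_top"
          by (intro filterlim_compose[OF exp_at_bot]) (simp add: filterlim_uminus_at_top mult.commute)
        from tendsto_mult_left_zero[OF this, of 2]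
        have "((\<lambda>\<tau>. exp (- \<tau> * u) * ((sin \<tau> - u * cos \<tau>) / (1 + u\<^sup>2))) \<longlongrightarrow> 0) at_top"
          by (rule Lim_null_comparison[rotated]) (use small[OF True] in auto)
        from tendsto_add[OF tendsto_const this, of "u / (1 + u\<^sup>2)"]
        have "((\<lambda>\<tau>. J \<tau> u) \<longlongrightarrow> u / (1 + u\<^sup>2)) at_top" unfolding split by simp
        then show ?thesis unfolding g_def by (intro tendsto_intros)
      qed (simp add: g_def)
    qed
    show "\<forall>\<^sub>F \<tau> in at_top. AE u in lborel. norm (indicator {0<..} u * (u powr (- \<mu>) * J \<tau> u)) \<le> ?w u"
      using eventually_ge_at_top[of 1]
    proof eventually_elim
      case (elim \<tau>)
      show ?case
      proof (rule AE_I2)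
        fix u :: real
        show "norm (indicator {0<..} u * (u powr (- \<mu>) * J \<tau> u)) \<le> ?w u"
        proof (cases "u > 0")
          case True
          have "exp (- \<tau> * u) \<le> exp (- 1 * u)" using True elim by simp
          with small[OF True, of \<tau>] have "\<bar>exp (- \<tau> * u) * ((sin \<tau> - u * cos \<tau>) / (1 + u\<^sup>2))\<bar> \<le> 2 * exp (- 1 * u)" by linarith
          moreover have "0 \<le> u / (1 + u\<^sup>2)" using True by simp
          ultimately have "\<bar>J \<tau> u\<bar> \<le> u / (1 + u\<^sup>2) + 2 * exp (- 1 * u)" unfolding split by linarith
          then have "u powr (- \<mu>) * \<bar>J \<tau> u\<bar> \<le> u powr (- \<mu>) * (u / (1 + u\<^sup>2) + 2 * exp (- 1 * u))"
            by (intro mult_left_mono) auto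
          then show ?thesis using True by (simp add: g_def abs_mult distrib_left mult_ac)
        qed (simp add: g_def)
      qed
    qed
  qed (auto simp: J_def)
  then have "((\<lambda>\<tau>. Gamma (1 - \<mu>) * ?I \<tau>) \<longlongrightarrow> pi / (2 * sin (pi * \<mu> / 2))) at_top"
    unfolding has_bochner_integral_integral_eq[OF hb_g]
    by (rule Lim_transform_eventually) (rule eventually_mono[OF eventually_gt_at_top[of 0]], rule swap[symmetric])
  from tendsto_divide[OF this tendsto_const, of "Gamma (1 - \<mu>)"]
  have "(?I \<longlongrightarrow> pi / (2 * sin (pi * \<mu> / 2)) / Gamma (1 - \<mu>)) at_top" using Gpos by simp
  \<comment> \<open>The reflection formula expresses \<open>pi\<close> through
    \<open>sin (pi * \<mu>)\<close>; doubling the angle cancels the half-angle sine and leaves the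
    cosine.\<close>
  moreover have "pi / (2 * sin (pi * \<mu> / 2)) / Gamma (1 - \<mu>) = Gamma \<mu> * cos (\<mu> * pi / 2)"
  proof -
    have s: "sin (pi * \<mu> / 2) > 0" "sin (pi * \<mu>) > 0"
      using \<mu> by (auto intro!: sin_gt_zero)
    have "sin (pi * \<mu>) = 2 * sin (pi * \<mu> / 2) * cos (pi * \<mu> / 2)"
      using sin_double[of "pi * \<mu> / 2"] by simp
    moreover have "pi = Gamma \<mu> * Gamma (1 - \<mu>) * sin (pi * \<mu>)"
      using Gamma_reflection_real[of \<mu>] s by (simp add: field_simps)
    ultimately have "pi = (Gamma \<mu> * cos (pi * \<mu> / 2)) * (2 * sin (pi * \<mu> / 2) * Gamma (1 - \<mu>))"
      by (simp add: mult_ac)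
    then have "pi / (2 * sin (pi * \<mu> / 2) * Gamma (1 - \<mu>)) = Gamma \<mu> * cos (pi * \<mu> / 2)"
      using s(1) Gpos by (subst nonzero_divide_eq_eq) auto
    then show ?thesis by (simp add: mult.commute)
  qed
  ultimately show ?thesis by simp
qed

section \<open>The value at the origin\<close>

text \<open>The substitution is first proved as an equality of measures, tested on indicators, and
  so transfers to Bochner integrals of arbitrary measurable functions.\<close>

lemma integral_exp_substitution:
  fixes f :: "real \<Rightarrow> 'a :: {banach, second_countable_topology}"
  assumes [measurable]: "f \<in> borel_measurable borel"
  shows "(\<integral>r. indicat_real {0<..} r *\<^sub>R f r \<partial>lborel) = (\<integral>s. exp s *\<^sub>R f (exp s) \<partial>lborel)"
proof -
  have "density lborel (\<lambda>r. ennreal (indicat_real {0<..} r)) = distr (density lborel (\<lambda>s. ennreal (exp s))) borel (exp :: real \<Rightarrow> real)"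
  proof (rule measure_eqI)
    fix X :: "real set"
    assume "X \<in> sets (density lborel (\<lambda>r. ennreal (indicat_real {0<..} r)))"
    then have [measurable]: "X \<in> sets borel" by simp
    have "exp \<in> borel_measurable (borel :: real measure)" by measurable
    then have [measurable]: "(exp :: real \<Rightarrow> real) -` X \<in> sets borel"
      using measurable_sets[of exp borel borel X] by simp
    have "emeasure (distr (density lborel (\<lambda>s. ennreal (exp s))) borel (exp :: real \<Rightarrow> real)) X =
        (\<integral>\<^sup>+s. ennreal (indicator X (exp s) * exp s) \<partial>lborel)"
      by (simp add: emeasure_distr emeasure_density ennreal_mult' indicator_vimage mult.commute ennreal_indicator)
    also have "\<dots> = (\<integral>\<^sup>+r. ennreal (indicator X r) * indicator {0<..} r \<partial>lborel)"
      by (rule nn_integral_exp_substitution[symmetric]) auto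
    also have "\<dots> = emeasure (density lborel (\<lambda>r. ennreal (indicat_real {0<..} r))) X"
      by (simp add: emeasure_density ennreal_indicator mult.commute)
    finally show "emeasure (density lborel (\<lambda>r. ennreal (indicat_real {0<..} r))) X =
        emeasure (distr (density lborel (\<lambda>s. ennreal (exp s))) borel (exp :: real \<Rightarrow> real)) X" ..
  qed simp
  then have "(\<integral>r. f r \<partial>density lborel (\<lambda>r. ennreal (indicat_real {0<..} r))) =
      (\<integral>r. f r \<partial>distr (density lborel (\<lambda>s. ennreal (exp s))) borel (exp :: real \<Rightarrow> real))"
    by (simp only:)
  then show ?thesis
    by (simp add: integral_density integral_distr)
qed

lemma integral_exp_mult_indicator_less_0:
  fixes \<mu> :: real
  assumes "\<mu> > 0"
  shows "(\<integral>s. exp (s * \<mu>) * indicat_real {..<0} s \<partial>lborel) = 1 / \<mu>"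
proof -
  have "(\<integral>s. exp (s * \<mu>) * indicat_real {..<0} s \<partial>lborel) =
      \<bar>- 1\<bar> *\<^sub>R (\<integral>s. exp ((0 + - 1 * s) * \<mu>) * indicat_real {..<0} (0 + - 1 * s) \<partial>lborel)"
    by (rule lborel_integral_real_affine) simp
  also have "\<dots> = (\<integral>s. indicator {0<..} s * (s powr (1 - 1) * exp (- \<mu> * s)) \<partial>lborel)"
    unfolding abs_minus abs_one scaleR_one
    by (intro Bochner_Integration.integral_cong) (auto simp: indicator_def mult.commute)
  also have "\<dots> = Gamma 1 * \<mu> powr (- 1)"
    by (rule has_bochner_integral_integral_eq[OF has_bochner_integral_powr_exp]) (use assms in auto)
  finally show ?thesis using assms by (simp add: powr_minus divide_inverse)
qed

context homogeneous_function
begin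

text \<open>For a function of \<open>\<bar>Q\<bar>\<close> alone, the integral along the orbit of
  \<open>\<eta>\<close> depends on \<open>\<eta>\<close> only through a time shift by
  \<open>ln \<bar>Q \<eta>\<bar>\<close>. Hence the polar formula factors into a constant
  \<open>c\<close> and a one-dimensional integral, and testing with the indicator of the unit
  sublevel set identifies \<open>c\<close>.\<close>

lemma radial_integral:
  fixes k :: "real \<Rightarrow> real"
  assumes [measurable]: "k \<in> borel_measurable borel" and k: "integrable lborel (\<lambda>\<xi>. k \<bar>Q \<xi>\<bar>)"
  shows "(\<integral>\<xi>. k \<bar>Q \<xi>\<bar> \<partial>lborel) =
    \<mu> * measure lborel {\<xi>. \<bar>Q \<xi>\<bar> < 1} * (\<integral>r. indicator {0<..} r * (r powr (\<mu> - 1) * k r) \<partial>lborel)"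
proof -
  define c where "c = (\<integral>\<eta>. indicat_real shell \<eta> * exp (- ln \<bar>Q \<eta>\<bar> * \<mu>) \<partial>lborel)"
  have log: "(\<integral>\<xi>. h \<bar>Q \<xi>\<bar> \<partial>lborel) = c * (\<integral>s. exp (s * \<mu>) * h (exp s) \<partial>lborel)"
    if h: "integrable lborel (\<lambda>\<xi>. h \<bar>Q \<xi>\<bar>)" for h :: "real \<Rightarrow> real"
  proof -
    have "(\<integral>s. exp (s * \<mu>) *\<^sub>R h \<bar>Q (T s *v \<eta>)\<bar> \<partial>lborel) =
        exp (- ln \<bar>Q \<eta>\<bar> * \<mu>) * (\<integral>s. exp (s * \<mu>) * h (exp s) \<partial>lborel)" if "\<eta> \<in> shell" for \<eta>
    proof -
      have p: "\<bar>Q \<eta>\<bar> > 0" using that by auto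
      have "(\<integral>s. exp (s * \<mu>) *\<^sub>R h \<bar>Q (T s *v \<eta>)\<bar> \<partial>lborel) = (\<integral>s. exp (s * \<mu>) * h (exp s * \<bar>Q \<eta>\<bar>) \<partial>lborel)"
        by (simp add: homogeneous abs_mult)
      also have "\<dots> = \<bar>1\<bar> *\<^sub>R (\<integral>s. exp ((- ln \<bar>Q \<eta>\<bar> + 1 * s) * \<mu>) * h (exp (- ln \<bar>Q \<eta>\<bar> + 1 * s) * \<bar>Q \<eta>\<bar>) \<partial>lborel)"
        by (rule lborel_integral_real_affine) simp
      also have "\<dots> = (\<integral>s. exp (- ln \<bar>Q \<eta>\<bar> * \<mu>) * (exp (s * \<mu>) * h (exp s)) \<partial>lborel)"
      proof -
        have "exp (- ln \<bar>Q \<eta>\<bar> + 1 * s) * \<bar>Q \<eta>\<bar> = exp s" for s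
          using p by (simp only: exp_add exp_minus exp_ln) simp
        moreover have "exp ((- ln \<bar>Q \<eta>\<bar> + 1 * s) * \<mu>) = exp (- ln \<bar>Q \<eta>\<bar> * \<mu>) * exp (s * \<mu>)" for s
          by (simp add: algebra_simps flip: exp_add)
        ultimately show ?thesis by (simp only: abs_one scaleR_one mult.assoc)
      qed
      finally show ?thesis by (simp only: integral_mult_right_zero)
    qed
    then have "indicat_real shell \<eta> *\<^sub>R (\<integral>s. exp (s * \<mu>) *\<^sub>R h \<bar>Q (T s *v \<eta>)\<bar> \<partial>lborel) =
        indicat_real shell \<eta> * exp (- ln \<bar>Q \<eta>\<bar> * \<mu>) * (\<integral>s. exp (s * \<mu>) * h (exp s) \<partial>lborel)" for \<eta>
      by (cases "\<eta> \<in> shell") (simp_all only: indicator_simps, simp_all)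
    then show ?thesis
      unfolding polar_integral[OF h] c_def by (simp only: integral_mult_left_zero)
  qed
  have "measure lborel {\<xi>. \<bar>Q \<xi>\<bar> < 1} = c * (1 / \<mu>)"
  proof -
    have eq: "(\<lambda>\<xi>. indicat_real {..<1} \<bar>Q \<xi>\<bar>) = indicat_real {\<xi>. \<bar>Q \<xi>\<bar> < 1}"
      by (auto simp: indicator_def)
    have "integrable lborel (\<lambda>\<xi>. indicat_real {..<1} \<bar>Q \<xi>\<bar>)"
      unfolding eq using emeasure_sublevel_finite[of 1] by (intro integrable_real_indicator) auto
    from log[OF this] have "measure lborel {\<xi>. \<bar>Q \<xi>\<bar> < 1} = c * (\<integral>s. exp (s * \<mu>) * indicat_real {..<1} (exp s) \<partial>lborel)"
      unfolding eq by simp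
    moreover have "indicat_real {..<1} (exp s) = indicat_real {..<0} s" for s :: real
      by (simp add: indicator_def)
    ultimately show ?thesis
      using integral_exp_mult_indicator_less_0[OF \<mu>_pos] by (simp only:)
  qed
  then have c: "c = \<mu> * measure lborel {\<xi>. \<bar>Q \<xi>\<bar> < 1}" using \<mu>_pos by simp
  have "(\<integral>r. indicator {0<..} r * (r powr (\<mu> - 1) * k r) \<partial>lborel) = (\<integral>s. exp s * (exp s powr (\<mu> - 1) * k (exp s)) \<partial>lborel)"
    using integral_exp_substitution[of "\<lambda>r. r powr (\<mu> - 1) * k r"] by simp
  also have "\<dots> = (\<integral>s. exp (s * \<mu>) * k (exp s) \<partial>lborel)"
    by (intro Bochner_Integration.integral_cong) (simp_all add: powr_def algebra_simps flip: exp_add)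
  finally show ?thesis unfolding log[OF k] c by simp
qed

text \<open>At \<open>x = 0\<close> the real part of the integrand is \<open>cos (Q \<xi>)\<close>;
  cosine being even, the sign of \<open>Q\<close> disappears and the function is radial.\<close>

lemma Re_osc_int_0:
  "Re (osc_int Q \<tau> 1 0) = \<mu> * measure lborel {\<xi>. \<bar>Q \<xi>\<bar> < 1} *
    (\<integral>r. indicator {0<..<\<tau>} r * (r powr (\<mu> - 1) * cos r) \<partial>lborel)"
proof -
  define k where "k r = indicat_real {..<\<tau>} r * cos r" for r
  have [measurable]: "k \<in> borel_measurable borel" unfolding k_def by measurable
  have int: "integrable lborel (\<lambda>\<xi>. indicat_real {\<xi>. \<bar>Q \<xi>\<bar> < \<tau>} \<xi> *\<^sub>R integrand 1 0 \<xi>)"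
    by (rule integrable_indicator_integrand[OF sublevel_sets order_refl])
  have Re: "Re (indicat_real {\<xi>. \<bar>Q \<xi>\<bar> < \<tau>} \<xi> *\<^sub>R integrand 1 0 \<xi>) = k \<bar>Q \<xi>\<bar>" for \<xi>
    by (auto simp: k_def indicator_def integrand_def Re_exp cos_abs_real)
  have k: "integrable lborel (\<lambda>\<xi>. k \<bar>Q \<xi>\<bar>)"
    using integrable_Re[OF int] unfolding Re .
  have "Re (osc_int Q \<tau> 1 0) = (\<integral>\<xi>. k \<bar>Q \<xi>\<bar> \<partial>lborel)"
    unfolding osc_int_eq Re[symmetric] by (rule integral_Re[OF int, symmetric])
  also have "\<dots> = \<mu> * measure lborel {\<xi>. \<bar>Q \<xi>\<bar> < 1} * (\<integral>r. indicator {0<..} r * (r powr (\<mu> - 1) * k r) \<partial>lborel)"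
    by (rule radial_integral[OF _ k]) measurable
  also have "(\<lambda>r. indicator {0<..} r * (r powr (\<mu> - 1) * k r)) = (\<lambda>r. indicator {0<..<\<tau>} r * (r powr (\<mu> - 1) * cos r))"
    by (auto simp: k_def indicator_def fun_eq_iff)
  finally show ?thesis .
qed

text \<open>Scaling reduces to \<open>t = 1\<close>, where the factor \<open>\<mu>\<close> of the
  radial density turns \<open>Gamma \<mu>\<close> into \<open>Gamma (1 + \<mu>)\<close>.\<close>

lemma Re_H_iQ_0:
  assumes "\<mu> < 1" "t > 0"
  shows "Re (H_iQ Q t 0) = t powr (- \<mu>) / (2 * pi) ^ CARD('n) * measure lborel {\<xi>. \<bar>Q \<xi>\<bar> < 1}
    * Gamma (1 + \<mu>) * cos (\<mu> * pi / 2)"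
proof -
  let ?c = "(2 * pi) ^ CARD('n)"
  let ?m = "measure lborel {\<xi>. \<bar>Q \<xi>\<bar> < 1}"
  have "((\<lambda>\<tau>. Re (osc_int Q \<tau> 1 0)) \<longlongrightarrow> Re (complex_of_real ?c * H_iQ Q 1 0)) at_top"
    by (intro tendsto_Re tendsto_osc_int assms) simp
  moreover have "((\<lambda>\<tau>. Re (osc_int Q \<tau> 1 0)) \<longlongrightarrow> \<mu> * ?m * (Gamma \<mu> * cos (\<mu> * pi / 2))) at_top"
    unfolding Re_osc_int_0
    by (intro tendsto_mult tendsto_const tendsto_integral_powr_mult_cos \<mu>_pos assms)
  ultimately have "Re (complex_of_real ?c * H_iQ Q 1 0) = \<mu> * ?m * (Gamma \<mu> * cos (\<mu> * pi / 2))"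
    using tendsto_unique[OF trivial_limit_at_top_linorder] by blast
  moreover have "Re (complex_of_real ?c * H_iQ Q 1 0) = ?c * Re (H_iQ Q 1 0)"
    by (simp only: Re_complex_of_real Im_complex_of_real times_complex.simps)
  moreover have "Gamma (1 + \<mu>) = \<mu> * Gamma \<mu>"
  proof -
    have "\<mu> \<notin> \<int>\<^sub>\<le>\<^sub>0" using \<mu>_pos by (auto elim!: nonpos_Ints_cases)
    from Gamma_plus1[OF this] show ?thesis by (simp only: add.commute)
  qed
  ultimately have "Re (H_iQ Q 1 0) = ?m * Gamma (1 + \<mu>) * cos (\<mu> * pi / 2) / ?c"
    by (simp add: field_simps)
  moreover have "Re (H_iQ Q t 0) = t powr (- \<mu>) * Re (H_iQ Q 1 0)"
    using H_iQ_scaling[OF assms, of 0] by simp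
  ultimately show ?thesis by simp
qed

end

section \<open>Exponents of \<open>Q\<close> and of its absolute value, and the theorem\<close>

lemma ExpSet_mexp:
  assumes "E \<in> ExpSet P"
  shows "P (mexp (s *\<^sub>R E) *v \<xi>) = exp s * P \<xi>"
  using assms unfolding ExpSet_def tpow_def by (metis (mono_tags, lifting) exp_gt_zero ln_exp mem_Collect_eq)

text \<open>Along the orbit of a point with \<open>Q \<xi> \<noteq> 0\<close> the function never
  vanishes, so by connectedness of the line its sign is constant. This links
  \<open>hom_order\<close>, taken from \<open>\<bar>Q\<bar>\<close>, to the exponents of the signed
  \<open>Q\<close>.\<close>

lemma ExpSet_abs_eq:
  assumes contQ: "continuous_on UNIV Q" and pos: "\<And>\<xi>. Q \<xi> = 0 \<Longrightarrow> \<xi> = 0"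
  shows "ExpSet (\<lambda>\<xi>. \<bar>Q \<xi>\<bar>) = ExpSet Q"
proof (intro equalityI subsetI)
  fix E assume "E \<in> ExpSet Q"
  then show "E \<in> ExpSet (\<lambda>\<xi>. \<bar>Q \<xi>\<bar>)" by (simp add: ExpSet_def abs_mult)
next
  fix E assume E: "E \<in> ExpSet (\<lambda>\<xi>. \<bar>Q \<xi>\<bar>)"
  have abs: "\<bar>Q (mexp (s *\<^sub>R E) *v \<xi>)\<bar> = exp s * \<bar>Q \<xi>\<bar>" for s \<xi>
    using ExpSet_mexp[OF E] .
  have "Q (mexp (s *\<^sub>R E) *v \<xi>) = exp s * Q \<xi>" for s \<xi>
  proof (cases "Q \<xi> = 0")
    case True
    with abs[of s \<xi>] show ?thesis by simp
  next
    case False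
    let ?q = "\<lambda>s. Q (mexp (s *\<^sub>R E) *v \<xi>)"
    have nz: "?q s \<noteq> 0" for s using abs[of s \<xi>] False by auto
    have "continuous_on UNIV ?q"
      by (intro continuous_on_compose2[OF contQ] continuous_intros) auto
    then have conn: "connected (range ?q)"
      by (rule connected_continuous_image) simp
    have mem: "Q \<xi> \<in> range ?q" "?q s \<in> range ?q"
      by (auto intro!: range_eqI[of _ _ 0])
    have "?q s > 0 \<longleftrightarrow> Q \<xi> > 0"
    proof (rule ccontr)
      assume "\<not> ?thesis"
      then have "(?q s \<le> 0 \<and> 0 \<le> Q \<xi>) \<or> (Q \<xi> \<le> 0 \<and> 0 \<le> ?q s)" by linarith
      then have "0 \<in> range ?q"
        using connectedD_interval[OF conn mem(1,2)] connectedD_interval[OF conn mem(2,1)] by blast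
      with nz show False by force
    qed
    then show ?thesis
      using abs[of s \<xi>] nz[of s] False by (auto simp: abs_if split: if_splits)
  qed
  then show "E \<in> ExpSet Q" by (simp add: ExpSet_def tpow_def)
qed

lemma homogeneous_functionI:
  assumes "continuous_on UNIV Q" and "pos_homogeneous (\<lambda>\<xi>. \<bar>Q \<xi>\<bar>)" and "E \<in> ExpSet Q"
  shows "homogeneous_function Q E"
  using assms by unfold_locales (auto simp: pos_homogeneous_def pos_definite_def ExpSet_mexp)

text \<open>The volume of \<open>\<bar>Q\<bar> < exp 1\<close> is \<open>exp (trace E)\<close> times
  that of \<open>\<bar>Q\<bar> < 1\<close> for every exponent \<open>E\<close>. As the latter is
  positive, all traces agree, including that of the exponent selected in
  \<open>hom_order\<close>.\<close>

lemma trace_ExpSet: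
  assumes "continuous_on UNIV Q" and hom: "pos_homogeneous (\<lambda>\<xi>. \<bar>Q \<xi>\<bar>)" and "E \<in> ExpSet Q"
  shows "trace E = hom_order (\<lambda>\<xi>. \<bar>Q \<xi>\<bar>)"
proof -
  let ?E = "SOME E. E \<in> ExpSet (\<lambda>\<xi>. \<bar>Q \<xi>\<bar>)"
  have "ExpSet (\<lambda>\<xi>. \<bar>Q \<xi>\<bar>) = ExpSet Q"
    using assms by (intro ExpSet_abs_eq) (auto simp: pos_homogeneous_def pos_definite_def)
  moreover have "?E \<in> ExpSet (\<lambda>\<xi>. \<bar>Q \<xi>\<bar>)"
    using hom by (simp add: pos_homogeneous_def some_in_eq)
  ultimately have E: "?E \<in> ExpSet Q" by simp
  interpret E: homogeneous_function Q E by (intro homogeneous_functionI assms)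
  interpret F: homogeneous_function Q ?E by (intro homogeneous_functionI assms E)
  have "exp (1 * trace E) = exp (1 * trace ?E)"
    using E.measure_sublevel_exp[of 1] F.measure_sublevel_exp[of 1] E.measure_sublevel_1_pos by simp
  then show ?thesis by (simp add: hom_order_def)
qed

theorem mainTheorem5:
  fixes Q :: "real^'n \<Rightarrow> real"
  assumes contQ: "continuous_on UNIV Q"
    and hom: "pos_homogeneous (\<lambda>\<xi>. \<bar>Q \<xi>\<bar>)"
    and mu_lt: "hom_order (\<lambda>\<xi>. \<bar>Q \<xi>\<bar>) < 1"
  shows
    "((\<forall>t>0. \<forall>x. ((\<lambda>\<tau>. osc_int Q \<tau> t x) \<longlongrightarrow>
          complex_of_real ((2 * pi) ^ CARD('n)) * H_iQ Q t x) at_top)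
      \<and> continuous_on ({0<..} \<times> UNIV) (\<lambda>p. H_iQ Q (fst p) (snd p)))
   \<and> (\<forall>t0 K \<epsilon>. t0 > 0 \<longrightarrow> compact K \<longrightarrow> \<epsilon> > 0 \<longrightarrow>
       (\<exists>\<tau>0. \<forall>\<tau>\<ge>\<tau>0. \<forall>t\<ge>t0. \<forall>x\<in>K.
         norm (complex_of_real ((2 * pi) ^ CARD('n)) * H_iQ Q t x - osc_int Q \<tau> t x) < \<epsilon>))
   \<and> (\<forall>E t x. E \<in> ExpSet Q \<longrightarrow> t > 0 \<longrightarrow>
       H_iQ Q t x = complex_of_real (t powr (- hom_order (\<lambda>\<xi>. \<bar>Q \<xi>\<bar>)))
                    * H_iQ Q 1 (tpow t (- transpose E) *v x))
   \<and> (\<forall>t. t > 0 \<longrightarrow>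
       Re (H_iQ Q t 0) = t powr (- hom_order (\<lambda>\<xi>. \<bar>Q \<xi>\<bar>)) / (2 * pi) ^ CARD('n)
          * measure lborel {\<xi>. \<bar>Q \<xi>\<bar> < 1}
          * Gamma (1 + hom_order (\<lambda>\<xi>. \<bar>Q \<xi>\<bar>))
          * cos (hom_order (\<lambda>\<xi>. \<bar>Q \<xi>\<bar>) * pi / 2)
       \<and> Re (H_iQ Q t 0) > 0)"
proof -
  let ?\<mu> = "hom_order (\<lambda>\<xi>. \<bar>Q \<xi>\<bar>)"
  have "ExpSet (\<lambda>\<xi>. \<bar>Q \<xi>\<bar>) = ExpSet Q"
    using contQ hom by (intro ExpSet_abs_eq) (auto simp: pos_homogeneous_def pos_definite_def)
  then obtain E where E: "E \<in> ExpSet Q"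
    using hom by (auto simp: pos_homogeneous_def)
  interpret homogeneous_function Q E
    by (intro homogeneous_functionI contQ hom E)
  have \<mu>: "trace E = ?\<mu>"
    by (rule trace_ExpSet[OF contQ hom E])
  then have lt: "trace E < 1" using mu_lt by simp
  have part1: "((\<lambda>\<tau>. osc_int Q \<tau> t x) \<longlongrightarrow> complex_of_real ((2 * pi) ^ CARD('n)) * H_iQ Q t x) at_top"
    if "t > 0" for t x
    by (rule tendsto_osc_int[OF lt that])
  have part2: "\<exists>\<tau>0. \<forall>\<tau>\<ge>\<tau>0. \<forall>t\<ge>t0. \<forall>x\<in>K.
      norm (complex_of_real ((2 * pi) ^ CARD('n)) * H_iQ Q t x - osc_int Q \<tau> t x) < \<epsilon>"
    if t0: "t0 > 0" and K: "compact K" and \<epsilon>: "\<epsilon> > 0" for t0 K \<epsilon>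
  proof -
    obtain X where X: "\<And>x. x \<in> K \<Longrightarrow> norm x \<le> X"
      using compact_imp_bounded[OF K] unfolding bounded_iff by blast
    obtain \<tau>0 where \<tau>0: "\<And>\<tau> p. \<tau> \<ge> \<tau>0 \<Longrightarrow> p \<in> {t0..} \<times> cball 0 X \<Longrightarrow>
        dist (osc_int Q \<tau> (fst p) (snd p)) (complex_of_real ((2 * pi) ^ CARD('n)) * H_iQ Q (fst p) (snd p)) < \<epsilon>"
      using uniform_limitD[OF uniform_limit_osc_int[OF lt t0, of X] \<epsilon>]
      unfolding eventually_at_top_linorder by blast
    show ?thesis
    proof (intro exI allI impI ballI)
      fix \<tau> t x assume "\<tau> \<ge> \<tau>0" "t \<ge> t0" "x \<in> K"
      then show "norm (complex_of_real ((2 * pi) ^ CARD('n)) * H_iQ Q t x - osc_int Q \<tau> t x) < \<epsilon>"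
        using \<tau>0[of \<tau> "(t, x)"] X[of x] by (simp only: dist_norm norm_minus_commute) simp
    qed
  qed
  have part3: "H_iQ Q t x = complex_of_real (t powr (- ?\<mu>)) * H_iQ Q 1 (tpow t (- transpose F) *v x)"
    if "F \<in> ExpSet Q" "t > 0" for F t x
  proof -
    \<comment> \<open>The scaling law is claimed for every exponent, so the locale is entered anew
      with \<open>F\<close> in place of the chosen \<open>E\<close>.\<close>
    interpret F: homogeneous_function Q F
      by (intro homogeneous_functionI contQ hom that)
    show ?thesis
      using F.H_iQ_scaling[OF _ that(2)] mu_lt unfolding trace_ExpSet[OF contQ hom that(1)] by blast
  qed
  have part4: "Re (H_iQ Q t 0) = t powr (- ?\<mu>) / (2 * pi) ^ CARD('n)
      * measure lborel {\<xi>. \<bar>Q \<xi>\<bar> < 1} * Gamma (1 + ?\<mu>) * cos (?\<mu> * pi / 2)" (is "_ = ?R t")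
    if "t > 0" for t
    using Re_H_iQ_0[OF lt that] unfolding \<mu> .
  have "?R t > 0" if "t > 0" for t
  proof -
    have "?\<mu> > 0" using \<mu>_pos unfolding \<mu> .
    moreover have "?\<mu> * pi < 1 * pi" using mu_lt by (intro mult_strict_right_mono) auto
    ultimately have "cos (?\<mu> * pi / 2) > 0" "Gamma (1 + ?\<mu>) > 0"
      by (auto intro!: cos_gt_zero_pi Gamma_real_pos intro: less_trans[of _ 0])
    then show ?thesis
      using measure_sublevel_1_pos that by (intro mult_pos_pos divide_pos_pos) auto
  qed
  with part4 have part4': "Re (H_iQ Q t 0) = ?R t \<and> Re (H_iQ Q t 0) > 0" if "t > 0" for t
    using that by metis
  show ?thesis
    by (intro conjI[OF conjI] conjI[OF _ conjI] allI impI part1 continuous_on_H_iQ lt)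
      (use part2 part3 part4' in blast)+
qed

end
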